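(* Let $\Bbbk$ be an algebraically closed field of characteristic zero, let $q\in\Bbbk^\ast$ be not a root of unity, and let $A_q^1(\Bbbk)=\Bbbk\langle X,Y\mid YX-qXY=1\rangle$. Let $H$ be the derivation of $A_q^1(\Bbbk)$ determined by $H(X)=X$, $H(Y)=-Y$. Then $$\mathrm{Der}(A_q^1(\Bbbk))=\mathrm{Inn}(A_q^1(\Bbbk))\oplus\Bbbk H.$$ Equivalently, every derivation $D\in\mathrm{Der}(A_q^1(\Bbbk))$ can be written uniquely in the form $D=\mathrm{ad}_w+cH$, where $c\in\Bbbk$ and $w\in A_q^1(\Bbbk)$ is determined modulo the center of $A_q^1(\Bbbk)$.
   Context: $\mathrm{Der}(A)$ denotes the $\Bbbk$-vector space of $\Bbbk$-linear derivations of a $\Bbbk$-algebra $A$; for $w\in A$, $\mathrm{ad}_w(b)=wb-bw$, and $\mathrm{Inn}(A)=\{\mathrm{ad}_w\mid w\in A\}$ is the set of inner derivations. The algebra $A_q^1(\Bbbk)$ is called the first quantum Weyl algebra. *)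

theory Defs
  imports
    "HOL-Library.Poly_Mapping"
    "HOL-Computational_Algebra.Polynomial"
    "HOL-Algebra.Algebraic_Closure_Type"
    "HOL-Algebra.QuotRing"
    "HOL-Algebra.Module"
begin

text \<open>
  Ground fields are types of class \<^class>\<open>field\<close>. An associative (not necessarily commutative)
  algebra over \<open>'k\<close> is a record of type \<open>('k, 'a) module\<close>; the field itself, where a
  record is required, is \<^const>\<open>ring_of_type_algebra\<close>.
\<close>

text \<open>
  The free algebra is the monoid algebra of the free monoid. The wrapper around lists
  carries the additively written (noncommutative) concatenation monoid, so that the product of
  \<open>'x monomial \<Rightarrow>\<^sub>0 'k\<close> is the convolution product provided by the library.
\<close>

datatype 'x monomial = Monomial (letters: "'x list")

instantiation monomial :: (type) monoid_add
begin

definition zero_monomial :: "'a monomial"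
  where "0 = Monomial []"

definition plus_monomial :: "'a monomial \<Rightarrow> 'a monomial \<Rightarrow> 'a monomial"
  where "u + v = Monomial (letters u @ letters v)"

instance
  by standard (simp_all add: zero_monomial_def plus_monomial_def)

end

definition free_algebra :: "('k::field, 'x monomial \<Rightarrow>\<^sub>0 'k) module"
  where "free_algebra =
    \<lparr>carrier = UNIV, monoid.mult = (*), one = 1, ring.zero = 0, add = (+),
     module.smult = (\<lambda>c. Poly_Mapping.map ((*) c))\<rparr>"

definition free_gen :: "'x \<Rightarrow> ('x monomial \<Rightarrow>\<^sub>0 'k::field)"
  where "free_gen x = Poly_Mapping.single (Monomial [x]) 1"

text \<open>The ring \<^term>\<open>A Quot I\<close> with the scalar multiplication \<open>c (I + a) = I + c a\<close>.\<close>

definition quot_algebra :: "('k, 'a) module \<Rightarrow> 'a set \<Rightarrow> ('k, 'a set) module"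
  where "quot_algebra A I =
    \<lparr>carrier = carrier (A Quot I), monoid.mult = monoid.mult (A Quot I),
     one = one (A Quot I), ring.zero = ring.zero (A Quot I), add = add (A Quot I),
     module.smult = (\<lambda>c S. \<Union>a\<in>S. I +>\<^bsub>A\<^esub> (c \<odot>\<^bsub>A\<^esub> a))\<rparr>"

text \<open>
  Maps on an algebra are taken extensional (\<^const>\<open>undefined\<close> off the carrier), so that
  equality of derivations is equality of functions.
\<close>

definition Der :: "('k, 'a) module \<Rightarrow> ('a \<Rightarrow> 'a) set"
  where "Der A = {D \<in> carrier A \<rightarrow>\<^sub>E carrier A.
    (\<forall>a\<in>carrier A. \<forall>b\<in>carrier A. D (a \<oplus>\<^bsub>A\<^esub> b) = D a \<oplus>\<^bsub>A\<^esub> D b) \<and>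
    (\<forall>c. \<forall>a\<in>carrier A. D (c \<odot>\<^bsub>A\<^esub> a) = c \<odot>\<^bsub>A\<^esub> D a) \<and>
    (\<forall>a\<in>carrier A. \<forall>b\<in>carrier A.
       D (a \<otimes>\<^bsub>A\<^esub> b) = (D a \<otimes>\<^bsub>A\<^esub> b) \<oplus>\<^bsub>A\<^esub> (a \<otimes>\<^bsub>A\<^esub> D b))}"

definition ad :: "('k, 'a) module \<Rightarrow> 'a \<Rightarrow> 'a \<Rightarrow> 'a"
  where "ad A w = (\<lambda>b\<in>carrier A. (w \<otimes>\<^bsub>A\<^esub> b) \<ominus>\<^bsub>A\<^esub> (b \<otimes>\<^bsub>A\<^esub> w))"

definition Inn :: "('k, 'a) module \<Rightarrow> ('a \<Rightarrow> 'a) set"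
  where "Inn A = ad A ` carrier A"

definition algebra_center :: "('k, 'a) module \<Rightarrow> 'a set"
  where "algebra_center A = {z \<in> carrier A. \<forall>a\<in>carrier A. z \<otimes>\<^bsub>A\<^esub> a = a \<otimes>\<^bsub>A\<^esub> z}"

text \<open>
  \<^term>\<open>Der A\<close> as a vector space with pointwise operations. The fields \<open>mult\<close> and
  \<open>one\<close>, which records for modules inherit from rings, play no role.
\<close>

definition Der_space :: "('k, 'a) module \<Rightarrow> ('k, 'a \<Rightarrow> 'a) module"
  where "Der_space A =
    \<lparr>carrier = Der A, monoid.mult = undefined, one = undefined,
     ring.zero = (\<lambda>a\<in>carrier A. \<zero>\<^bsub>A\<^esub>),
     add = (\<lambda>D E. \<lambda>a\<in>carrier A. D a \<oplus>\<^bsub>A\<^esub> E a),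
     module.smult = (\<lambda>c D. \<lambda>a\<in>carrier A. c \<odot>\<^bsub>A\<^esub> D a)\<rparr>"

definition line :: "('k, 'v) module \<Rightarrow> 'v \<Rightarrow> 'v set"
  where "line V v = range (\<lambda>c. c \<odot>\<^bsub>V\<^esub> v)"

definition is_internal_direct_sum ::
    "('k::field, 'v) module \<Rightarrow> 'v set \<Rightarrow> 'v set \<Rightarrow> bool"
  where "is_internal_direct_sum V U W \<longleftrightarrow>
    module ring_of_type_algebra V \<and>
    submodule U ring_of_type_algebra V \<and> submodule W ring_of_type_algebra V \<and>
    carrier V = U <+>\<^bsub>V\<^esub> W \<and> U \<inter> W = {\<zero>\<^bsub>V\<^esub>}"

datatype weyl_letter = LX | LY

abbreviation (input) free_X :: "weyl_letter monomial \<Rightarrow>\<^sub>0 'k::field"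
  where "free_X \<equiv> free_gen LX"

abbreviation (input) free_Y :: "weyl_letter monomial \<Rightarrow>\<^sub>0 'k::field"
  where "free_Y \<equiv> free_gen LY"

definition weyl_ideal :: "'k::field \<Rightarrow> (weyl_letter monomial \<Rightarrow>\<^sub>0 'k) set"
  where "weyl_ideal q =
    Idl\<^bsub>free_algebra\<^esub> {free_Y * free_X - q \<odot>\<^bsub>free_algebra\<^esub> (free_X * free_Y) - 1}"

definition quantum_weyl :: "'k::field \<Rightarrow> ('k, (weyl_letter monomial \<Rightarrow>\<^sub>0 'k) set) module"
  where "quantum_weyl q = quot_algebra free_algebra (weyl_ideal q)"

definition weyl_X :: "'k::field \<Rightarrow> (weyl_letter monomial \<Rightarrow>\<^sub>0 'k) set"
  where "weyl_X q = weyl_ideal q +>\<^bsub>free_algebra\<^esub> free_X"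

definition weyl_Y :: "'k::field \<Rightarrow> (weyl_letter monomial \<Rightarrow>\<^sub>0 'k) set"
  where "weyl_Y q = weyl_ideal q +>\<^bsub>free_algebra\<^esub> free_Y"

definition is_weyl_H ::
    "'k::field \<Rightarrow> ((weyl_letter monomial \<Rightarrow>\<^sub>0 'k) set \<Rightarrow> (weyl_letter monomial \<Rightarrow>\<^sub>0 'k) set) \<Rightarrow> bool"
  where "is_weyl_H q H \<longleftrightarrow> H \<in> Der (quantum_weyl q) \<and>
    H (weyl_X q) = weyl_X q \<and> H (weyl_Y q) = \<ominus>\<^bsub>quantum_weyl q\<^esub> weyl_Y q"

text \<open>Meaningful only because \<^const>\<open>is_weyl_H\<close> has exactly one solution, which has to be proved.\<close>

definition weyl_H ::
    "'k::field \<Rightarrow> (weyl_letter monomial \<Rightarrow>\<^sub>0 'k) set \<Rightarrow> (weyl_letter monomial \<Rightarrow>\<^sub>0 'k) set"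
  where "weyl_H q = (THE H. is_weyl_H q H)"

end

theory Submission
  imports Defs
begin

text \<open>
  Write \<open>z = YX - XY\<close>. Then \<open>zX = qXz\<close> and \<open>zY = q\<^sup>-\<^sup>1 Yz\<close>, while \<open>XY = (z - 1)/(q - 1)\<close>
  and \<open>YX = (qz - 1)/(q - 1)\<close>. So the algebra is graded with \<open>deg X = 1\<close>, \<open>deg Y = -1\<close>, its
  component of degree \<open>n\<close> being \<open>\<Bbbk>[z] X\<^sup>n\<close> or \<open>\<Bbbk>[z] Y\<^sup>-\<^sup>n\<close>, and commutation with \<open>z\<close>
  scales each component by its own power of \<open>q\<close>. These powers are distinct since \<open>q\<close> is not a
  root of unity.

  Modulo \<open>z\<close> the algebra is commutative. A derivation \<open>D\<close> sends \<open>z\<close> to a sum of commutators,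
  hence to a multiple of \<open>z\<close> (\<open>commutator_z_multiple\<close>). Bracketing with \<open>z\<close> reaches all multiples
  of \<open>z\<close> outside degree \<open>0\<close> (\<open>z_multiple_inner\<close>), so after subtracting an inner derivation
  \<open>D z\<close> is a polynomial in \<open>z\<close>. The commutation rules with \<open>z\<close> then force
  \<open>D X = f(z) X\<close>, \<open>D Y = h(z) Y\<close> and \<open>D z = \<lambda> z\<close> (\<open>z_eigenvector\<close>); the relation
  between \<open>YX\<close> and \<open>z\<close> yields \<open>\<lambda> = 0\<close> and \<open>h(z) = -f(qz)\<close>. Writing
  \<open>f(z) = c + u(z) - u(q\<^sup>-\<^sup>1 z)\<close> gives \<open>D = ad u(z) + c H\<close> (\<open>rep_der_grade0\<close>). The constant
  \<open>c\<close> cannot be absorbed, because the \<open>q\<close>-difference \<open>u(z) - u(q\<^sup>-\<^sup>1 z)\<close> has no constant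
  term; so \<open>H\<close> is outer and the sum is direct (\<open>euler_not_inner\<close>).

  All this presupposes that the elements \<open>z\<^sup>k X\<^sup>m\<close> and \<open>z\<^sup>k Y\<^sup>m\<close> form a basis. They span by
  rewriting modulo the defining relation (\<open>spanned_all\<close>), and they are independent because they act
  by independent operators on sequences, \<open>X\<close> as the shift and \<open>Y\<close> as the \<open>q\<close>-derivative
  (\<open>laurent_eq_0\<close>). This representation is faithful on the quotient (\<open>rep_eq_0_iff\<close>), and the
  computations take place in the ring of operators. There \<open>H\<close> is the commutator with
  \<open>t d/dt\<close>, which settles its existence.
\<close>

section \<open>Operators on sequences\<close>

text \<open>
  The additive endomorphisms of the space of sequences form a ring that does not depend on
  \<open>q\<close> and contains a copy of the quantum Weyl algebra for every \<open>q\<close> that is neither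
  zero nor a root of unity. Computations in the quotient thus become ring identities between operators.
\<close>

typedef (overloaded) ('k::field) seq_endo =
  "{F :: (nat \<Rightarrow> 'k) \<Rightarrow> (nat \<Rightarrow> 'k). \<forall>u v. F (\<lambda>n. u n + v n) = (\<lambda>n. F u n + F v n)}"
  morphisms app Abs_seq_endo
  by (rule exI[of _ "\<lambda>u. u"]) simp

setup_lifting type_definition_seq_endo

instantiation seq_endo :: (field) ring_1
begin

lift_definition zero_seq_endo :: "'a seq_endo" is "\<lambda>u n. 0" by simp
lift_definition one_seq_endo :: "'a seq_endo" is "\<lambda>u. u" by simp
lift_definition plus_seq_endo :: "'a seq_endo \<Rightarrow> 'a seq_endo \<Rightarrow> 'a seq_endo"
  is "\<lambda>F G u n. F u n + G u n" by (auto simp: algebra_simps)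
lift_definition minus_seq_endo :: "'a seq_endo \<Rightarrow> 'a seq_endo \<Rightarrow> 'a seq_endo"
  is "\<lambda>F G u n. F u n - G u n" by (auto simp: algebra_simps)
lift_definition uminus_seq_endo :: "'a seq_endo \<Rightarrow> 'a seq_endo"
  is "\<lambda>F u n. - F u n" by (auto simp: algebra_simps)
lift_definition times_seq_endo :: "'a seq_endo \<Rightarrow> 'a seq_endo \<Rightarrow> 'a seq_endo"
  is "\<lambda>F G u. F (G u)" by simp

instance
proof
  show "(0::'a seq_endo) \<noteq> 1"
    by transfer (metis one_neq_zero)
qed (transfer; simp add: fun_eq_iff algebra_simps)+

end

lemma seq_endo_eqI: "(\<And>u n. app F u n = app G u n) \<Longrightarrow> F = G"
  by (simp add: app_inject[symmetric] fun_eq_iff)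

lemma app_sum: "app (sum f A) u n = (\<Sum>a\<in>A. app (f a) u n)"
  by (induction A rule: infinite_finite_induct)
    (simp_all add: zero_seq_endo.rep_eq plus_seq_endo.rep_eq)

lemmas app_simps = zero_seq_endo.rep_eq one_seq_endo.rep_eq plus_seq_endo.rep_eq
  minus_seq_endo.rep_eq uminus_seq_endo.rep_eq times_seq_endo.rep_eq app_sum

lift_definition diag :: "(nat \<Rightarrow> 'k::field) \<Rightarrow> 'k seq_endo"
  is "\<lambda>d u n. d n * u n" by (simp add: algebra_simps)

lift_definition shift :: "'k::field seq_endo"
  is "\<lambda>u n. case n of 0 \<Rightarrow> 0 | Suc m \<Rightarrow> u m" by (auto simp: fun_eq_iff split: nat.split)

text \<open>
  For \<open>q \<noteq> 1\<close> this is the \<open>q\<close>-derivative, written on coefficient sequences: it sends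
  \<open>t\<^sup>n\<^sup>+\<^sup>1\<close> to \<open>(1 + q + \<dots> + q\<^sup>n) t\<^sup>n\<close>.
\<close>

lift_definition lower :: "'k::field \<Rightarrow> 'k seq_endo"
  is "\<lambda>q u n. inverse (q - 1) * (q * q ^ n - 1) * u (Suc n)" by (simp add: algebra_simps)

text \<open>
  Since \<open>z\<close> acts as multiplication by \<open>q\<^sup>n\<close> on the \<open>n\<close>-th coefficient, this is
  the operator \<open>f(z)\<close>.
\<close>

definition pol :: "'k::field \<Rightarrow> 'k poly \<Rightarrow> 'k seq_endo"
  where "pol q f = diag (\<lambda>n. poly f (q ^ n))"

lemmas app_gens = diag.rep_eq shift.rep_eq lower.rep_eq

lemma pol_0 [simp]: "pol q 0 = 0"
  and pol_1 [simp]: "pol q 1 = 1"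
  and pol_add: "pol q (f + g) = pol q f + pol q g"
  and pol_diff: "pol q (f - g) = pol q f - pol q g"
  and pol_mult: "pol q (f * g) = pol q f * pol q g"
  by (auto intro!: seq_endo_eqI simp: pol_def app_simps app_gens algebra_simps)

lemma pol_commute: "pol q f * pol q g = pol q g * pol q f"
  by (simp add: pol_mult[symmetric] mult.commute)

lemma pol_shift:
  assumes "q \<noteq> 0"
  shows "shift * pol q f = pol q (f \<circ>\<^sub>p [:0, inverse q:]) * shift"
proof -
  have "q * q ^ n * inverse q = q ^ n" for n
    using assms by simp
  then show ?thesis
    using assms by (auto intro!: seq_endo_eqI
        simp: pol_def app_simps app_gens poly_pcompose field_simps split: nat.split)
qed

lemma lower_pol: "lower q * pol q f = pol q (f \<circ>\<^sub>p [:0, q:]) * lower q"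
  by (auto intro!: seq_endo_eqI simp: pol_def app_simps app_gens poly_pcompose mult_ac)

lemma pol_const_commute:
  "shift * pol q [:c:] = pol q [:c:] * shift"
  "lower q * pol q [:c:] = pol q [:c:] * lower q"
  by (auto intro!: seq_endo_eqI simp: pol_def app_simps app_gens split: nat.split)

text \<open>
  Because both products of the generators are polynomials in \<open>z\<close>, a component of the grading
  consists of the multiples \<open>f(z) X\<^sup>n\<close>, or \<open>f(z) Y\<^sup>n\<close>, of one single power.
\<close>

lemma lower_shift: "lower q * shift = pol q ([:-1, q:] * [:inverse (q - 1):])"
  by (auto intro!: seq_endo_eqI simp: pol_def app_simps app_gens algebra_simps)

lemma shift_lower: "shift * lower q = pol q ([:-1, 1:] * [:inverse (q - 1):])"
  by (auto intro!: seq_endo_eqI simp: pol_def app_simps app_gens algebra_simps split: nat.split)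

abbreviation euler :: "'k::field seq_endo"
  where "euler \<equiv> diag of_nat"

text \<open>
  The derivation \<open>H\<close> becomes inner in the larger ring of all operators: it is the commutator
  with \<open>t d/dt\<close>, the operator multiplying the \<open>n\<close>-th coefficient by \<open>n\<close>.
\<close>

lemma euler_shift: "euler * shift - shift * euler = shift"
 by (auto intro!: seq_endo_eqI simp: app_simps app_gens pol_def algebra_simps split: nat.split)

lemma euler_lower: "euler * lower q - lower q * euler = - lower q"
 by (auto intro!: seq_endo_eqI simp: app_simps app_gens pol_def algebra_simps split: nat.split)

lemma euler_pol: "euler * pol q f = pol q f * euler"
 by (auto intro!: seq_endo_eqI simp: app_simps app_gens pol_def algebra_simps split: nat.split)

section \<open>The free algebra and its representation\<close>

lemma poly_mapping_add_induct [case_names single add]: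
  assumes "\<And>k v. P (Poly_Mapping.single k v)" "\<And>f g. P f \<Longrightarrow> P g \<Longrightarrow> P (f + g)"
  shows "P (f :: 'a \<Rightarrow>\<^sub>0 'b::comm_monoid_add)"
proof -
  have "P (\<Sum>k\<in>K. Poly_Mapping.single k (Poly_Mapping.lookup f k))" if "finite K" for K
    using that by induction (use assms(1)[of undefined 0] assms in auto)
  moreover have "f = (\<Sum>k\<in>Poly_Mapping.keys f. Poly_Mapping.single k (Poly_Mapping.lookup f k))"
    by (rule poly_mapping_eqI) (simp add: lookup_sum lookup_single when_def in_keys_iff)
  ultimately show ?thesis by (metis finite_keys)
qed

abbreviation const :: "'k::field \<Rightarrow> ('x monomial \<Rightarrow>\<^sub>0 'k)"
  where "const c \<equiv> Poly_Mapping.single 0 c"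

lemma const_commute: "p * const c = const c * (p :: 'x monomial \<Rightarrow>\<^sub>0 'k::field)"
  by (induction p rule: poly_mapping_add_induct) (simp_all add: mult_single algebra_simps)

lemma const_mult: "const c * const d = const (c * d)"
  by (simp add: mult_single)

lemma smult_free_algebra: "c \<odot>\<^bsub>free_algebra\<^esub> p = const c * p"
  by (simp add: free_algebra_def mult_map_scale_conv_mult)

text \<open>
  Everything that is multiplicative up to correction terms, such as a derivation or membership in a
  subalgebra, is checked on scalars and letters through this rule.
\<close>

lemma free_algebra_induct [case_names const gen add mult]:
  fixes p :: "'x monomial \<Rightarrow>\<^sub>0 'k::field"
  assumes "\<And>c. P (const c)" "\<And>x. P (free_gen x)"
    and "\<And>p r. P p \<Longrightarrow> P r \<Longrightarrow> P (p + r)" "\<And>p r. P p \<Longrightarrow> P r \<Longrightarrow> P (p * r)"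
  shows "P p"
proof (induction p rule: poly_mapping_add_induct)
  case (single k c)
  obtain w where k: "k = Monomial w" by (cases k)
  have "P (Poly_Mapping.single (Monomial w) 1)"
  proof (induction w)
    case Nil
    then show ?case using assms(1)[of 1] by (simp add: zero_monomial_def)
  next
    case (Cons x w)
    have "Poly_Mapping.single (Monomial (x # w)) (1::'k)
        = free_gen x * Poly_Mapping.single (Monomial w) 1"
      by (simp add: free_gen_def mult_single plus_monomial_def)
    then show ?case using assms(2,4) Cons by simp
  qed
  then have "P (const c * Poly_Mapping.single k 1)" using assms(1,4) k by simp
  then show ?case by (simp add: mult_single)
qed (fact assms(3))

fun weyl_op :: "'k::field \<Rightarrow> weyl_letter \<Rightarrow> 'k seq_endo"
  where "weyl_op q LX = shift" | "weyl_op q LY = lower q"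

definition rep :: "'k::field \<Rightarrow> (weyl_letter monomial \<Rightarrow>\<^sub>0 'k) \<Rightarrow> 'k seq_endo"
  where "rep q p = (\<Sum>m\<in>Poly_Mapping.keys p.
    pol q [:Poly_Mapping.lookup p m:] * prod_list (map (weyl_op q) (letters m)))"

lemma pol_const_add: "pol q [:c + d:] = pol q [:c:] + pol q [:d:]"
  by (simp add: pol_add[symmetric])

lemma rep_single:
  "rep q (Poly_Mapping.single m c) = pol q [:c:] * prod_list (map (weyl_op q) (letters m))"
  by (simp add: rep_def)

lemma rep_const [simp]: "rep q (const c) = pol q [:c:]"
  by (simp add: rep_single zero_monomial_def)

lemma rep_0 [simp]: "rep q 0 = 0" and rep_1 [simp]: "rep q 1 = 1"
  using rep_const[of q 0] rep_const[of q 1] by (simp_all flip: one_pCons)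

lemma rep_gen [simp]: "rep q (free_gen a) = weyl_op q a"
  by (simp add: rep_single free_gen_def flip: one_pCons)

lemma rep_add: "rep q (p + r) = rep q p + rep q r"
  unfolding rep_def
  by (rule setsum_keys_plus_distrib) (simp_all add: pol_const_add distrib_right)

lemma rep_diff: "rep q (p - r) = rep q p - rep q r"
  using rep_add[of q "p - r" r] by (simp add: algebra_simps)

lemma rep_sum: "rep q (sum f A) = (\<Sum>a\<in>A. rep q (f a))"
  by (induction A rule: infinite_finite_induct) (simp_all add: rep_add)

lemma pol_const_word:
  "prod_list (map (weyl_op q) w) * pol q [:c:] = pol q [:c:] * prod_list (map (weyl_op q) w)"
proof (induction w)
  case (Cons a w)
  have "weyl_op q a * pol q [:c:] = pol q [:c:] * weyl_op q a"
    by (cases a) (simp_all add: pol_const_commute)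
  then show ?case using Cons by simp (metis mult.assoc)
qed simp

lemma rep_mult: "rep q (p * r) = rep q p * rep q r"
proof (induction p rule: poly_mapping_add_induct)
  case (single k c)
  show ?case
  proof (induction r rule: poly_mapping_add_induct)
    case (single l d)
    let ?W = "\<lambda>m. prod_list (map (weyl_op q) (letters m))"
    have "rep q (Poly_Mapping.single k c * Poly_Mapping.single l d)
        = pol q ([:c:] * [:d:]) * (?W k * ?W l)"
      by (simp add: mult_single rep_single plus_monomial_def mult.commute)
    also have "\<dots> = pol q [:c:] * (pol q [:d:] * ?W k) * ?W l"
      by (simp only: pol_mult mult.assoc)
    also have "\<dots> = (pol q [:c:] * ?W k) * (pol q [:d:] * ?W l)"
      by (subst pol_const_word[symmetric]) (simp only: mult.assoc)
    finally show ?case by (simp add: rep_single)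
  qed (simp add: rep_add distrib_left)
qed (simp add: rep_add distrib_right)

lemma rep_power: "rep q (p ^ n) = rep q p ^ n"
  by (induction n) (simp_all add: rep_mult)

lemma ring_free_algebra: "ring (free_algebra :: ('k::field, 'x monomial \<Rightarrow>\<^sub>0 'k) module)"
proof -
  have "\<exists>y. y + x = 0" for x :: "'x monomial \<Rightarrow>\<^sub>0 'k"
    by (rule exI[of _ "- x"]) simp
  then show ?thesis
    by (intro ringI abelian_groupI monoidI)
      (auto simp: free_algebra_def add_ac mult.assoc distrib_left distrib_right)
qed

definition weyl_rel :: "'k::field \<Rightarrow> (weyl_letter monomial \<Rightarrow>\<^sub>0 'k)"
  where "weyl_rel q = free_gen LY * free_gen LX - const q * (free_gen LX * free_gen LY) - 1"

lemma weyl_ideal_eq: "weyl_ideal q = Idl\<^bsub>free_algebra\<^esub> {weyl_rel q}"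
  by (simp add: weyl_ideal_def weyl_rel_def smult_free_algebra)

lemma ideal_weyl_ideal: "ideal (weyl_ideal q) free_algebra"
  unfolding weyl_ideal_eq by (rule ring.genideal_ideal[OF ring_free_algebra]) (simp add: free_algebra_def)

lemma weyl_rel_mem: "weyl_rel q \<in> weyl_ideal q"
  unfolding weyl_ideal_eq using ring.genideal_self[OF ring_free_algebra, of "{weyl_rel q}"]
  by (simp add: free_algebra_def)

lemma weyl_ideal_closed:
  shows weyl_ideal_0: "0 \<in> weyl_ideal q"
    and weyl_ideal_add: "a \<in> weyl_ideal q \<Longrightarrow> b \<in> weyl_ideal q \<Longrightarrow> a + b \<in> weyl_ideal q"
    and weyl_ideal_mult_left: "a \<in> weyl_ideal q \<Longrightarrow> p * a \<in> weyl_ideal q"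
    and weyl_ideal_mult_right: "a \<in> weyl_ideal q \<Longrightarrow> a * p \<in> weyl_ideal q"
proof -
  interpret ideal "weyl_ideal q" free_algebra by (rule ideal_weyl_ideal)
  show "0 \<in> weyl_ideal q"
    "a \<in> weyl_ideal q \<Longrightarrow> b \<in> weyl_ideal q \<Longrightarrow> a + b \<in> weyl_ideal q"
    "a \<in> weyl_ideal q \<Longrightarrow> p * a \<in> weyl_ideal q"
    "a \<in> weyl_ideal q \<Longrightarrow> a * p \<in> weyl_ideal q"
    using additive_subgroup.a_closed[OF is_additive_subgroup, of a b]
      additive_subgroup.zero_closed[OF is_additive_subgroup] I_l_closed[of a p] I_r_closed[of a p]
    by (simp_all add: free_algebra_def)
qed

lemma weyl_ideal_uminus: "a \<in> weyl_ideal q \<Longrightarrow> - a \<in> weyl_ideal q"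
  using weyl_ideal_mult_left[of a q "-1"] by simp

lemma weyl_ideal_diff: "a \<in> weyl_ideal q \<Longrightarrow> b \<in> weyl_ideal q \<Longrightarrow> a - b \<in> weyl_ideal q"
  using weyl_ideal_add[OF _ weyl_ideal_uminus] by fastforce

lemma rep_weyl_rel:
  assumes "q \<noteq> 1"
  shows "rep q (weyl_rel q) = 0"
proof -
  define i where "i = inverse (q - 1)"
  have i: "i * q = 1 + i"
    using assms by (simp add: i_def field_simps)
  have "rep q (weyl_rel q) = pol q ([:-1, q:] * [:i:]) - pol q [:q:] * pol q ([:-1, 1:] * [:i:]) - 1"
    by (simp only: weyl_rel_def rep_diff rep_mult rep_const rep_gen weyl_op.simps rep_1
        lower_shift shift_lower i_def)
  also have "\<dots> = pol q ([:-1, q:] * [:i:] - [:q:] * ([:-1, 1:] * [:i:]) - 1)"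
    by (simp only: pol_diff pol_mult[of q "[:q:]"] pol_1)
  also have "[:-1, q:] * [:i:] - [:q:] * ([:-1, 1:] * [:i:]) - 1 = 0"
    using i by (simp add: one_pCons mult.commute)
  finally show ?thesis by simp
qed

text \<open>
  The kernel of the representation is an ideal and contains the defining relation, hence the ideal
  generated by it.
\<close>

lemma rep_weyl_ideal:
  fixes q :: "'a::field"
  assumes "q \<noteq> 1" "p \<in> weyl_ideal q"
  shows "rep q p = 0"
proof -
  have "ideal {p. rep q p = 0} free_algebra"
  proof (rule idealI)
    have G: "group (add_monoid (free_algebra :: ('a, weyl_letter monomial \<Rightarrow>\<^sub>0 'a) module))"
      by (rule abelian_group.a_group[OF ring.is_abelian_group[OF ring_free_algebra]])
    show "subgroup {p. rep q p = 0} (add_monoid free_algebra)"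
    proof (rule group.subgroupI[OF G])
      fix a assume "a \<in> {p. rep q p = 0}"
      moreover have "inv\<^bsub>add_monoid free_algebra\<^esub> a + a = 0"
        using group.l_inv[OF G, of a] by (simp add: free_algebra_def)
      then have "rep q (inv\<^bsub>add_monoid free_algebra\<^esub> a) + rep q a = 0"
        by (simp flip: rep_add)
      ultimately show "inv\<^bsub>add_monoid free_algebra\<^esub> a \<in> {p. rep q p = 0}" by simp
    qed (auto simp: rep_add free_algebra_def intro: exI[of _ 0])
  qed (auto simp: rep_mult free_algebra_def ring_free_algebra[unfolded free_algebra_def])
  then have "weyl_ideal q \<subseteq> {p. rep q p = 0}"
    unfolding weyl_ideal_eq by (rule ring.genideal_minimal[OF ring_free_algebra]) (simp add: rep_weyl_rel assms)
  then show ?thesis using assms by auto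
qed

section \<open>Laurent expansions and their independence\<close>

text \<open>
  The power of degree \<open>n\<close> in the grading with \<open>deg X = 1\<close>, \<open>deg Y = -1\<close>;
  negative powers of \<open>X\<close> are replaced by powers of \<open>Y\<close>.
\<close>

definition grade_power :: "'r::monoid_mult \<Rightarrow> 'r \<Rightarrow> int \<Rightarrow> 'r"
  where "grade_power x y n = (if 0 \<le> n then x ^ nat n else y ^ nat (- n))"

definition weyl_pow :: "'k::field \<Rightarrow> int \<Rightarrow> 'k seq_endo"
  where "weyl_pow q = grade_power shift (lower q)"

lemma app_shift_power: "m \<le> i \<Longrightarrow> app (shift ^ m) u i = u (i - m)"
proof (induction m arbitrary: i)
  case (Suc m)
  then show ?case
    by (cases i) (simp_all add: app_simps app_gens)
qed (simp add: app_simps)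

locale non_root =
  fixes q :: "'k::field"
  assumes q_nonzero: "q \<noteq> 0" and q_power: "\<forall>n::nat. n > 0 \<longrightarrow> q ^ n \<noteq> 1"

lemma (in non_root) q_neq_1: "q \<noteq> 1"
  using q_power[rule_format, of 1] by simp

text \<open>
  The factor is a product of \<open>q\<close>-integers, and these are nonzero because \<open>q\<close> is not a
  root of unity.
\<close>

lemma (in non_root) app_lower_power:
  "\<exists>g. g \<noteq> 0 \<and> (\<forall>u. app (lower q ^ m) u i = g * u (i + m))"
proof (induction m arbitrary: i)
  case 0
  show ?case by (rule exI[of _ 1]) (simp add: app_simps)
next
  case (Suc m)
  obtain g where "g \<noteq> 0" "\<And>u. app (lower q ^ m) u (Suc i) = g * u (Suc i + m)"
    using Suc by blast
  moreover have "q * q ^ i \<noteq> 1" "q \<noteq> 1"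
    using q_power[rule_format, of "Suc i"] q_neq_1 by simp_all
  ultimately show ?case
    by (intro exI[of _ "inverse (q - 1) * (q * q ^ i - 1) * g"]) (simp add: app_simps app_gens)
qed

lemma (in non_root) app_weyl_pow:
  assumes "n \<le> int i"
  shows "\<exists>g. g \<noteq> 0 \<and> (\<forall>u. app (weyl_pow q n) u i = g * u (nat (int i - n)))"
proof (cases "0 \<le> n")
  case True
  then show ?thesis
    using assms by (intro exI[of _ 1])
      (auto simp: weyl_pow_def grade_power_def app_shift_power nat_diff_distrib nat_le_iff)
next
  case False
  then have "nat (int i - n) = i + nat (- n)" by simp
  then show ?thesis
    using app_lower_power[of "nat (- n)" i] False
    by (simp add: weyl_pow_def grade_power_def)
qed

lemma (in non_root) q_power_inj:
  "inj (\<lambda>n::nat. q ^ n)"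
proof (rule linorder_injI)
  fix m n :: nat assume "m < n"
  show "q ^ m \<noteq> q ^ n"
  proof
    assume "q ^ m = q ^ n"
    also have "q ^ n = q ^ m * q ^ (n - m)"
      using \<open>m < n\<close> by (simp flip: power_add)
    finally show False using q_power[rule_format, of "n - m"] \<open>m < n\<close> q_nonzero by simp
  qed
qed

lemma (in non_root) poly_eq_0_if_q_powers:
  assumes "\<And>i. N \<le> i \<Longrightarrow> poly f (q ^ i) = 0"
  shows "f = 0"
proof (rule ccontr)
  assume "f \<noteq> 0"
  then have "finite {x. poly f x = 0}" by (rule poly_roots_finite)
  moreover have "(\<lambda>n. q ^ n) ` {N..} \<subseteq> {x. poly f x = 0}"
    using assms by auto
  ultimately have "finite ((\<lambda>n. q ^ n) ` {N..})" by (rule finite_subset[rotated])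
  then have "finite {N..}"
    using finite_imageD inj_on_subset[OF q_power_inj] by blast
  then show False by (simp add: infinite_Ici)
qed

definition laurent :: "'k::field \<Rightarrow> (int \<Rightarrow>\<^sub>0 'k poly) \<Rightarrow> 'k seq_endo"
  where "laurent q f = (\<Sum>n\<in>Poly_Mapping.keys f. pol q (Poly_Mapping.lookup f n) * weyl_pow q n)"

text \<open>
  An operator of degree \<open>n\<close> only connects the coefficients \<open>i - n\<close> and \<open>i\<close>,
  so a matrix entry far enough along the \<open>n\<close>-th diagonal isolates the summand of degree
  \<open>n\<close>. That entry is a nonzero multiple of \<open>f\<^sub>n(q\<^sup>i)\<close>, and a polynomial with the
  infinitely many zeros \<open>q\<^sup>i\<close> vanishes.
\<close>

lemma (in non_root) laurent_eq_0:
  assumes "laurent q f = 0"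
  shows "f = 0"
proof (rule poly_mapping_eqI)
  fix n0
  \<comment> \<open>Beyond \<open>N\<close> the diagonals of all degrees that occur have started.\<close>
  define N where "N = nat \<bar>n0\<bar> + (\<Sum>n\<in>Poly_Mapping.keys f. nat \<bar>n\<bar>)"
  have "poly (Poly_Mapping.lookup f n0) (q ^ i) = 0" if "N \<le> i" for i
  proof (cases "n0 \<in> Poly_Mapping.keys f")
    case True
    have le: "n \<le> int i" if "n \<in> Poly_Mapping.keys f" for n
    proof -
      have "nat \<bar>n\<bar> \<le> N"
        unfolding N_def using member_le_sum[OF that, of "\<lambda>n. nat \<bar>n\<bar>"] by simp
      then show ?thesis using \<open>N \<le> i\<close> by linarith
    qed
    define u where "u = (\<lambda>j. if j = nat (int i - n0) then 1 else 0 :: 'k)"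
    obtain g where g: "g \<noteq> 0" "app (weyl_pow q n0) u i = g * u (nat (int i - n0))"
      using app_weyl_pow[OF le[OF True]] by blast
    have "0 = app (laurent q f) u i"
      by (simp add: assms app_simps)
    also have "\<dots> = (\<Sum>n\<in>Poly_Mapping.keys f.
        poly (Poly_Mapping.lookup f n) (q ^ i) * app (weyl_pow q n) u i)"
      by (simp add: laurent_def app_simps pol_def app_gens)
    also have "\<dots> = (\<Sum>n\<in>{n0}. poly (Poly_Mapping.lookup f n) (q ^ i) * app (weyl_pow q n) u i)"
    proof (rule sum.mono_neutral_right)
      show "\<forall>n\<in>Poly_Mapping.keys f - {n0}.
          poly (Poly_Mapping.lookup f n) (q ^ i) * app (weyl_pow q n) u i = 0"
      proof
        fix n assume n: "n \<in> Poly_Mapping.keys f - {n0}"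
        then obtain g' where "app (weyl_pow q n) u i = g' * u (nat (int i - n))"
          using app_weyl_pow[OF le] by blast
        moreover have "nat (int i - n) \<noteq> nat (int i - n0)"
          using n le[OF True] le[of n] by auto
        ultimately show "poly (Poly_Mapping.lookup f n) (q ^ i) * app (weyl_pow q n) u i = 0"
          by (simp add: u_def)
      qed
    qed (use True in auto)
    finally show ?thesis using g by (simp add: u_def)
  qed (simp add: in_keys_iff)
  then show "Poly_Mapping.lookup f n0 = Poly_Mapping.lookup 0 n0"
    using poly_eq_0_if_q_powers[of N "Poly_Mapping.lookup f n0"] by simp
qed

lemma laurent_add: "laurent q (f + g) = laurent q f + laurent q g"
  unfolding laurent_def
  by (rule setsum_keys_plus_distrib) (simp_all add: pol_add distrib_right)

lemma laurent_single: "laurent q (Poly_Mapping.single n f) = pol q f * weyl_pow q n"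
  by (simp add: laurent_def)

lemma laurent_diff: "laurent q (f - g) = laurent q f - laurent q g"
  using laurent_add[of q "f - g" g] by (simp add: algebra_simps)

definition free_z :: "weyl_letter monomial \<Rightarrow>\<^sub>0 'k::field"
  where "free_z = free_gen LY * free_gen LX - free_gen LX * free_gen LY"

text \<open>
  Evaluation at \<open>YX - XY\<close> is spelled out as a sum because the free algebra is not commutative.
\<close>

definition pol_lift :: "'k::field poly \<Rightarrow> (weyl_letter monomial \<Rightarrow>\<^sub>0 'k)"
  where "pol_lift f = (\<Sum>i\<le>degree f. const (coeff f i) * free_z ^ i)"

lemma pol_lift_bound: "degree f \<le> N \<Longrightarrow> pol_lift f = (\<Sum>i\<le>N. const (coeff f i) * free_z ^ i)"
  unfolding pol_lift_def by (rule sum.mono_neutral_left) (auto simp: coeff_eq_0)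

lemma pol_lift_0 [simp]: "pol_lift 0 = 0"
  by (simp add: pol_lift_def)

lemma pol_lift_add: "pol_lift (f + g) = pol_lift f + pol_lift g"
proof -
  let ?N = "max (degree f) (degree g)"
  have "degree (f + g) \<le> ?N" by (rule degree_add_le_max)
  then show ?thesis
    by (simp add: pol_lift_bound[of _ ?N] single_add distrib_right sum.distrib)
qed

lemma pol_lift_monom: "pol_lift (monom c k) = const c * free_z ^ k"
proof -
  have "pol_lift (monom c k) = (\<Sum>i\<le>k. const (coeff (monom c k) i) * free_z ^ i)"
    by (rule pol_lift_bound) (rule degree_monom_le)
  also have "\<dots> = (\<Sum>i\<in>{k}. const (coeff (monom c k) i) * free_z ^ i)"
    by (rule sum.mono_neutral_right) auto
  finally show ?thesis by simp
qed

lemma pol_power: "pol q (f ^ n) = pol q f ^ n"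
  by (induction n) (simp_all add: pol_mult)

lemma pol_sum: "pol q (sum f A) = (\<Sum>a\<in>A. pol q (f a))"
  by (induction A rule: infinite_finite_induct) (simp_all add: pol_add)

lemma rep_free_z:
  assumes "q \<noteq> 1"
  shows "rep q free_z = pol q [:0, 1:]"
proof -
  define i where "i = inverse (q - 1)"
  have i: "i * q = 1 + i"
    using assms by (simp add: i_def field_simps)
  have "rep q free_z = pol q ([:-1, q:] * [:i:] - [:-1, 1:] * [:i:])"
    by (simp only: free_z_def rep_diff rep_mult rep_gen weyl_op.simps
        lower_shift shift_lower i_def pol_diff)
  also have "[:-1, q:] * [:i:] - [:-1, 1:] * [:i:] = [:0, 1:]"
    using i by (simp add: mult.commute)
  finally show ?thesis .
qed

lemma rep_pol_lift:
  assumes "q \<noteq> 1"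
  shows "rep q (pol_lift f) = pol q f"
proof -
  have "rep q (pol_lift f) = (\<Sum>i\<le>degree f. pol q ([:coeff f i:] * [:0, 1:] ^ i))"
    by (simp only: pol_lift_def rep_sum rep_mult rep_const rep_power rep_free_z[OF assms]
        pol_mult pol_power)
  also have "\<dots> = pol q (\<Sum>i\<le>degree f. monom (coeff f i) i)"
    by (simp add: pol_sum monom_altdef)
  finally show ?thesis by (simp add: poly_as_sum_of_monoms)
qed

definition laurent_lift :: "(int \<Rightarrow>\<^sub>0 'k::field poly) \<Rightarrow> (weyl_letter monomial \<Rightarrow>\<^sub>0 'k)"
  where "laurent_lift f = (\<Sum>n\<in>Poly_Mapping.keys f.
    pol_lift (Poly_Mapping.lookup f n) * grade_power (free_gen LX) (free_gen LY) n)"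

lemma laurent_lift_add: "laurent_lift (f + g) = laurent_lift f + laurent_lift g"
  unfolding laurent_lift_def
  by (rule setsum_keys_plus_distrib) (simp_all add: pol_lift_add distrib_right)

lemma rep_grade_power: "rep q (grade_power (free_gen LX) (free_gen LY) n) = weyl_pow q n"
  by (simp add: grade_power_def weyl_pow_def rep_power)

lemma rep_laurent_lift: "q \<noteq> 1 \<Longrightarrow> rep q (laurent_lift f) = laurent q f"
  by (simp add: laurent_lift_def laurent_def rep_sum rep_mult rep_pol_lift rep_grade_power)

section \<open>Normal forms modulo the defining relation\<close>

definition weyl_cong :: "'k::field \<Rightarrow> (weyl_letter monomial \<Rightarrow>\<^sub>0 'k) \<Rightarrow> (weyl_letter monomial \<Rightarrow>\<^sub>0 'k) \<Rightarrow> bool"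
  where "weyl_cong q p r \<longleftrightarrow> p - r \<in> weyl_ideal q"

lemma weyl_cong_refl: "weyl_cong q p p"
  by (simp add: weyl_cong_def weyl_ideal_0)

lemma weyl_cong_sym: "weyl_cong q p r \<Longrightarrow> weyl_cong q r p"
  using weyl_ideal_uminus[of "p - r" q] by (simp add: weyl_cong_def)

lemma weyl_cong_trans [trans]: "weyl_cong q p r \<Longrightarrow> weyl_cong q r s \<Longrightarrow> weyl_cong q p s"
  using weyl_ideal_add[of "p - r" q "r - s"] by (simp add: weyl_cong_def)

lemma weyl_cong_add: "weyl_cong q p p' \<Longrightarrow> weyl_cong q r r' \<Longrightarrow> weyl_cong q (p + r) (p' + r')"
  using weyl_ideal_add[of "p - p'" q "r - r'"] by (simp add: weyl_cong_def algebra_simps)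

lemma weyl_cong_mult_left: "weyl_cong q p r \<Longrightarrow> weyl_cong q (s * p) (s * r)"
  using weyl_ideal_mult_left[of "p - r" q s] by (simp add: weyl_cong_def algebra_simps)

lemma weyl_cong_mult_right: "weyl_cong q p r \<Longrightarrow> weyl_cong q (p * s) (r * s)"
  using weyl_ideal_mult_right[of "p - r" q s] by (simp add: weyl_cong_def algebra_simps)

text \<open>
  Two terms suffice: passing \<open>z\<close> through a letter costs a commutator of that letter with the
  defining relation, and rewriting \<open>XY\<close> or \<open>YX\<close> in terms of \<open>z\<close> a single multiple of it.
\<close>

lemma weyl_congI: "p - r = s * weyl_rel q * t - s' * weyl_rel q * t' \<Longrightarrow> weyl_cong q p r"
  by (simp add: weyl_cong_def weyl_ideal_diff weyl_ideal_mult_left weyl_ideal_mult_right weyl_rel_mem)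

lemma const_left_commute: "p * (const c * r) = const c * (p * (r :: 'x monomial \<Rightarrow>\<^sub>0 'k::field))"
  by (metis const_commute mult.assoc)

lemma zX_cong: "weyl_cong q (free_z * free_gen LX) (const q * (free_gen LX * free_z))"
  by (rule weyl_congI[of _ _ 1 _ "free_gen LX" "free_gen LX" 1])
    (simp add: weyl_rel_def free_z_def algebra_simps const_left_commute[of "free_gen LX"]
      const_left_commute[of "free_gen LY"])

lemma Xz_cong:
  assumes "q \<noteq> 0"
  shows "weyl_cong q (free_gen LX * free_z) (const (inverse q) * (free_z * free_gen LX))"
  using weyl_cong_sym[OF weyl_cong_mult_left[OF zX_cong, of q "const (inverse q)"]] assms
  by (simp add: mult.assoc[symmetric] const_mult)

lemma Yz_cong: "weyl_cong q (free_gen LY * free_z) (const q * (free_z * free_gen LY))"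
  by (rule weyl_congI[of _ _ "free_gen LY" _ 1 1 "free_gen LY"])
    (simp add: weyl_rel_def free_z_def algebra_simps const_left_commute[of "free_gen LX"]
      const_left_commute[of "free_gen LY"])

lemma XY_YX_cong:
  fixes q :: "'k::field"
  assumes "q \<noteq> 1"
  shows "weyl_cong q (free_gen LX * free_gen LY) (const (inverse (q - 1)) * (free_z - 1))"
    and "weyl_cong q (free_gen LY * free_gen LX) (const (inverse (q - 1)) * (const q * free_z - 1))"
proof -
  define i where "i = inverse (q - 1)"
  have "i * q = 1 + i"
    using assms by (simp add: i_def field_simps)
  then have "const i * const q = (1 + const i :: weyl_letter monomial \<Rightarrow>\<^sub>0 'k)"
    by (simp only: const_mult single_add single_one)
  then have "const i * const q * s = (1 + const i) * s" for s :: "weyl_letter monomial \<Rightarrow>\<^sub>0 'k"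
    by (simp only:)
  then have iq: "const i * (const q * s) = s + const i * s" for s :: "weyl_letter monomial \<Rightarrow>\<^sub>0 'k"
    by (simp only: mult.assoc distrib_right mult_1)
  show "weyl_cong q (free_gen LX * free_gen LY) (const (inverse (q - 1)) * (free_z - 1))"
    by (rule weyl_congI[of _ _ 0 _ 0 "const i" 1])
      (simp add: weyl_rel_def free_z_def algebra_simps iq flip: i_def)
  show "weyl_cong q (free_gen LY * free_gen LX) (const (inverse (q - 1)) * (const q * free_z - 1))"
    by (rule weyl_congI[of _ _ 0 _ 0 "const i" 1])
      (simp add: weyl_rel_def free_z_def algebra_simps iq flip: i_def)
qed

lemma z_power_cong:
  assumes "weyl_cong q (w * free_z) (const c * (free_z * w))"
  shows "weyl_cong q (w * free_z ^ k) (const (c ^ k) * (free_z ^ k * w))"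
proof (induction k)
  case 0
  show ?case by (simp add: weyl_cong_refl)
next
  case (Suc k)
  have "w * free_z ^ Suc k = w * free_z * free_z ^ k"
    by (simp add: mult.assoc)
  also have "weyl_cong q \<dots> (const c * (free_z * w) * free_z ^ k)"
    by (rule weyl_cong_mult_right[OF assms])
  also have "const c * (free_z * w) * free_z ^ k = const c * free_z * (w * free_z ^ k)"
    by (simp add: mult.assoc)
  also have "weyl_cong q \<dots> (const c * free_z * (const (c ^ k) * (free_z ^ k * w)))"
    by (rule weyl_cong_mult_left[OF Suc])
  also have "const c * free_z * (const (c ^ k) * (free_z ^ k * w)) = const (c ^ Suc k) * (free_z ^ Suc k * w)"
    by (simp add: mult.assoc const_left_commute[of free_z] flip: const_mult)
  finally show ?case .
qed

abbreviation free_pow :: "int \<Rightarrow> weyl_letter monomial \<Rightarrow>\<^sub>0 'k::field"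
  where "free_pow \<equiv> grade_power (free_gen LX) (free_gen LY)"

definition spanned :: "'k::field \<Rightarrow> (weyl_letter monomial \<Rightarrow>\<^sub>0 'k) \<Rightarrow> bool"
  where "spanned q p \<longleftrightarrow> (\<exists>f. weyl_cong q p (laurent_lift f))"

lemma spanned_cong: "weyl_cong q p r \<Longrightarrow> spanned q r \<Longrightarrow> spanned q p"
  unfolding spanned_def using weyl_cong_trans by blast

lemma spanned_add: "spanned q p \<Longrightarrow> spanned q r \<Longrightarrow> spanned q (p + r)"
  unfolding spanned_def by (metis laurent_lift_add weyl_cong_add)

lemma spanned_sum:
  assumes "\<And>a. a \<in> A \<Longrightarrow> spanned q (f a)"
  shows "spanned q (sum f A)"
  using assms
proof (induction A rule: infinite_finite_induct)
  case (insert a A)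
  then show ?case by (simp add: spanned_add)
qed (auto simp: spanned_def laurent_lift_def intro!: exI[of _ 0] weyl_cong_refl)

lemma spanned_basis: "spanned q (const c * (free_z ^ k * free_pow n))"
  unfolding spanned_def
  by (rule exI[of _ "Poly_Mapping.single n (monom c k)"])
    (simp add: laurent_lift_def pol_lift_monom mult.assoc weyl_cong_refl)

lemma spanned_mult_left:
  assumes basis: "\<And>c k n. spanned q (u * (const c * (free_z ^ k * free_pow n)))" and "spanned q p"
  shows "spanned q (u * p)"
proof -
  obtain f where "weyl_cong q p (laurent_lift f)"
    using assms(2) by (auto simp: spanned_def)
  then have "weyl_cong q (u * p) (u * laurent_lift f)"
    by (rule weyl_cong_mult_left)
  moreover have "spanned q (u * laurent_lift f)"
    unfolding laurent_lift_def pol_lift_def sum_distrib_left sum_distrib_right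
    using basis by (intro spanned_sum) (simp add: mult.assoc)
  ultimately show ?thesis by (rule spanned_cong)
qed

text \<open>
  A letter \<open>w\<close> passes through \<open>z\<^sup>k\<close> up to a scalar, and then either extends the
  power of degree \<open>n\<close> or cancels one of its letters at the price of a factor linear in \<open>z\<close>.
\<close>

lemma spanned_gen_mult:
  assumes comm: "weyl_cong q (w * free_z) (const d * (free_z * w))"
    and step: "(\<exists>m. w * free_pow n = free_pow m) \<or>
      (\<exists>a b m. weyl_cong q (w * free_pow n) ((const a * free_z + const b) * free_pow m))"
  shows "spanned q (w * (const c * (free_z ^ k * free_pow n)))"
proof -
  have "w * (const c * (free_z ^ k * free_pow n)) = const c * (w * free_z ^ k) * free_pow n"
    by (simp add: const_left_commute[of w] mult.assoc)
  also have "weyl_cong q \<dots> (const c * (const (d ^ k) * (free_z ^ k * w)) * free_pow n)"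
    by (intro weyl_cong_mult_right weyl_cong_mult_left z_power_cong comm)
  also have "const c * (const (d ^ k) * (free_z ^ k * w)) * free_pow n
      = const (c * d ^ k) * free_z ^ k * (w * free_pow n)"
    by (simp add: mult.assoc flip: const_mult)
  finally have *: "weyl_cong q (w * (const c * (free_z ^ k * free_pow n)))
    (const (c * d ^ k) * free_z ^ k * (w * free_pow n))" .
  from step have "spanned q (const (c * d ^ k) * free_z ^ k * (w * free_pow n))"
  proof (elim disjE exE)
    fix m assume "w * free_pow n = free_pow m"
    then show ?thesis by (simp add: mult.assoc spanned_basis)
  next
    fix a b m assume "weyl_cong q (w * free_pow n) ((const a * free_z + const b) * free_pow m)"
    then have "weyl_cong q (const (c * d ^ k) * free_z ^ k * (w * free_pow n))
      (const (c * d ^ k) * free_z ^ k * ((const a * free_z + const b) * free_pow m))"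
      by (rule weyl_cong_mult_left)
    moreover have "const (c * d ^ k) * free_z ^ k * ((const a * free_z + const b) * free_pow m)
      = const (c * d ^ k * a) * (free_z ^ Suc k * free_pow m)
      + const (c * d ^ k * b) * (free_z ^ k * free_pow m)"
      by (simp add: distrib_left distrib_right mult.assoc const_left_commute[of "free_z ^ k"] power_Suc2
        del: power_Suc flip: const_mult)
    ultimately show ?thesis
      by (metis spanned_cong spanned_add spanned_basis)
  qed
  with * show ?thesis by (rule spanned_cong)
qed

lemma spanned_X_mult:
  assumes "q \<noteq> 0" "q \<noteq> 1" "spanned q p"
  shows "spanned q (free_gen LX * p)"
proof (rule spanned_mult_left[OF spanned_gen_mult[OF Xz_cong[OF assms(1)]] assms(3)])
  fix n :: int
  show "(\<exists>m. free_gen LX * free_pow n = free_pow m) \<or>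
      (\<exists>a b m. weyl_cong q (free_gen LX * free_pow n) ((const a * free_z + const b) * free_pow m))"
  proof (cases "0 \<le> n")
    case True
    then have "free_gen LX * free_pow n = free_pow (n + 1)"
      by (simp add: grade_power_def nat_add_distrib)
    then show ?thesis by blast
  next
    case False
    then have "nat (- n) = Suc (nat (- (n + 1)))" by simp
    with False have "free_gen LX * free_pow n = (free_gen LX * free_gen LY) * free_pow (n + 1)"
      by (auto simp: grade_power_def mult.assoc)
    also have "weyl_cong q \<dots> (const (inverse (q - 1)) * (free_z - 1) * free_pow (n + 1))"
      by (intro weyl_cong_mult_right XY_YX_cong assms)
    also have "const (inverse (q - 1)) * (free_z - 1)
        = const (inverse (q - 1)) * free_z + const (- inverse (q - 1))"
      by (simp add: algebra_simps single_uminus)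
    finally show ?thesis by blast
  qed
qed

lemma spanned_Y_mult:
  assumes "q \<noteq> 1" "spanned q p"
  shows "spanned q (free_gen LY * p)"
proof (rule spanned_mult_left[OF spanned_gen_mult[OF Yz_cong] assms(2)])
  fix n :: int
  show "(\<exists>m. free_gen LY * free_pow n = free_pow m) \<or>
      (\<exists>a b m. weyl_cong q (free_gen LY * free_pow n) ((const a * free_z + const b) * free_pow m))"
  proof (cases "n \<le> 0")
    case True
    then have "nat (- (n - 1)) = Suc (nat (- n))" by simp
    with True have "free_gen LY * free_pow n = free_pow (n - 1)"
      by (auto simp: grade_power_def)
    then show ?thesis by blast
  next
    case False
    then have "nat n = Suc (nat (n - 1))" by simp
    with False have "free_gen LY * free_pow n = (free_gen LY * free_gen LX) * free_pow (n - 1)"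
      by (auto simp: grade_power_def mult.assoc)
    also have "weyl_cong q \<dots> (const (inverse (q - 1)) * (const q * free_z - 1) * free_pow (n - 1))"
      by (intro weyl_cong_mult_right XY_YX_cong assms)
    also have "const (inverse (q - 1)) * (const q * free_z - 1)
        = const (inverse (q - 1) * q) * free_z + const (- inverse (q - 1))"
      by (simp add: right_diff_distrib single_uminus mult.assoc flip: const_mult)
    finally show ?thesis by blast
  qed
qed

text \<open>
  The span of the elements \<open>z\<^sup>k X\<^sup>m\<close>, \<open>z\<^sup>k Y\<^sup>m\<close> modulo the ideal is stable under
  left multiplication by letters and contains \<open>1\<close>.
\<close>

lemma spanned_all:
  assumes "q \<noteq> 0" "q \<noteq> 1"
  shows "spanned q p"
proof -
  have "spanned q r \<Longrightarrow> spanned q (p * r)" for r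
  proof (induction p arbitrary: r rule: free_algebra_induct)
    case (const c)
    show ?case
    proof (rule spanned_mult_left[OF _ const])
      show "spanned q (const c * (const c' * (free_z ^ k * free_pow n)))" for c' k n
        using spanned_basis[of q "c * c'" k n] by (simp add: mult.assoc flip: const_mult)
    qed
  next
    case (gen x)
    then show ?case
      by (cases x) (simp_all add: spanned_X_mult spanned_Y_mult assms)
  qed (simp_all add: distrib_right spanned_add mult.assoc)
  moreover have "spanned q 1"
    using spanned_basis[of q 1 0 0] by (simp add: grade_power_def)
  ultimately show ?thesis
    by (metis mult.right_neutral)
qed

text \<open>
  Spanning gives every element a Laurent expansion modulo the ideal, and independence makes the
  expansion of an element of the kernel zero. Hence the quotient algebra is faithfully represented
  by operators.
\<close>

lemma (in non_root) rep_eq_0_iff: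
  "rep q p = 0 \<longleftrightarrow> p \<in> weyl_ideal q"
proof
  show "rep q p = 0" if "p \<in> weyl_ideal q"
    using rep_weyl_ideal[OF q_neq_1 that] .
  show "p \<in> weyl_ideal q" if p: "rep q p = 0"
  proof -
    obtain f where f: "weyl_cong q p (laurent_lift f)"
      using spanned_all[OF q_nonzero q_neq_1] by (auto simp: spanned_def)
    then have "rep q (p - laurent_lift f) = 0"
      unfolding weyl_cong_def by (rule rep_weyl_ideal[OF q_neq_1])
    then have "laurent q f = 0"
      by (simp add: p rep_diff rep_laurent_lift[OF q_neq_1])
    then have "f = 0" by (rule laurent_eq_0)
    then show ?thesis using f by (simp add: weyl_cong_def laurent_lift_def)
  qed
qed

lemma rep_laurent_cases:
  assumes "q \<noteq> 0" "q \<noteq> 1"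
  obtains f where "rep q p = laurent q f"
proof -
  obtain f where "weyl_cong q p (laurent_lift f)"
    using spanned_all[OF assms] by (auto simp: spanned_def)
  then have "rep q (p - laurent_lift f) = 0"
    unfolding weyl_cong_def by (rule rep_weyl_ideal[OF assms(2)])
  then show ?thesis using that by (simp add: rep_diff rep_laurent_lift[OF assms(2)])
qed

section \<open>Divisibility by z\<close>

definition weyl_alg :: "'k::field \<Rightarrow> 'k seq_endo set"
  where "weyl_alg q = range (rep q)"

lemma weyl_alg_rep: "rep q p \<in> weyl_alg q"
  by (simp add: weyl_alg_def)

lemma weyl_alg_closed:
  shows weyl_alg_add: "s \<in> weyl_alg q \<Longrightarrow> t \<in> weyl_alg q \<Longrightarrow> s + t \<in> weyl_alg q"
    and weyl_alg_diff: "s \<in> weyl_alg q \<Longrightarrow> t \<in> weyl_alg q \<Longrightarrow> s - t \<in> weyl_alg q"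
    and weyl_alg_mult: "s \<in> weyl_alg q \<Longrightarrow> t \<in> weyl_alg q \<Longrightarrow> s * t \<in> weyl_alg q"
  by (auto simp: weyl_alg_def simp flip: rep_add rep_diff rep_mult)

lemma weyl_alg_gens:
  shows weyl_alg_0: "0 \<in> weyl_alg q"
    and weyl_alg_pol: "q \<noteq> 1 \<Longrightarrow> pol q f \<in> weyl_alg q"
  using weyl_alg_rep[of q 0] weyl_alg_rep[of q "pol_lift f"]
  by (simp_all add: rep_pol_lift)

lemma const_rep_commute: "pol q [:c:] * rep q p = rep q p * pol q [:c:]"
  by (metis const_commute rep_const rep_mult)

lemma weyl_alg_const_commute: "s \<in> weyl_alg q \<Longrightarrow> s * pol q [:c:] = pol q [:c:] * s"
  by (auto simp: weyl_alg_def const_rep_commute)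

abbreviation z_op :: "'k::field \<Rightarrow> 'k seq_endo"
  where "z_op q \<equiv> pol q [:0, 1:]"

lemma scale_z: "pol q [:0, c:] = pol q [:c:] * z_op q"
  by (simp flip: pol_mult)

lemma shift_z: "q \<noteq> 0 \<Longrightarrow> shift * z_op q = pol q [:inverse q:] * z_op q * shift"
  by (simp add: pol_shift pcompose_pCons flip: scale_z)

lemma lower_z: "lower q * z_op q = pol q [:q:] * z_op q * lower q"
  by (simp add: lower_pol pcompose_pCons flip: scale_z)

text \<open>
  The element \<open>z\<close> is normal, so its right multiples \<open>z s\<close> form a two-sided ideal.
\<close>

definition z_multiple :: "'k::field \<Rightarrow> 'k seq_endo \<Rightarrow> bool"
  where "z_multiple q s \<longleftrightarrow> (\<exists>t\<in>weyl_alg q. s = z_op q * t)"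

lemma rep_z_commute:
  assumes "q \<noteq> 0"
  shows "z_multiple q (rep q p * z_op q)"
proof (induction p rule: free_algebra_induct)
  case (const c)
  then show ?case
    using weyl_alg_rep[of q "const c"]
    by (auto simp: z_multiple_def intro!: bexI[of _ "pol q [:c:]"] pol_commute)
next
  case (gen x)
  have "pol q [:c:] * z_op q * weyl_op q x = z_op q * (pol q [:c:] * weyl_op q x)" for c
    by (simp add: pol_commute[of q "[:c:]"] mult.assoc)
  moreover have "pol q [:c:] * weyl_op q x \<in> weyl_alg q" for c
    using weyl_alg_rep[of q "const c * free_gen x"] by (simp add: rep_mult)
  ultimately show ?case
    unfolding z_multiple_def using shift_z[OF assms] lower_z[of q] by (cases x) auto
next
  case (add p r)
  then show ?case
    by (auto simp: z_multiple_def rep_add distrib_left distrib_right weyl_alg_add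
      intro!: bexI[of _ "_ + _"])
next
  case (mult p r)
  then obtain s t where "s \<in> weyl_alg q" "rep q p * z_op q = z_op q * s"
    "t \<in> weyl_alg q" "rep q r * z_op q = z_op q * t"
    by (auto simp: z_multiple_def)
  then have "rep q (p * r) * z_op q = z_op q * (s * t)" "s * t \<in> weyl_alg q"
    by (simp_all add: rep_mult mult.assoc weyl_alg_mult) (simp flip: mult.assoc)
  then show ?case by (auto simp: z_multiple_def)
qed

lemma z_multiple_add: "z_multiple q s \<Longrightarrow> z_multiple q t \<Longrightarrow> z_multiple q (s + t)"
  unfolding z_multiple_def by (metis distrib_left weyl_alg_add)

lemma z_multiple_mult_right: "z_multiple q s \<Longrightarrow> z_multiple q (s * rep q r)"
  unfolding z_multiple_def by (metis mult.assoc weyl_alg_mult weyl_alg_rep)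

lemma z_multiple_uminus: "z_multiple q s \<Longrightarrow> z_multiple q (- s)"
  unfolding z_multiple_def by (metis diff_0 mult_minus_right weyl_alg_0 weyl_alg_diff)

lemma z_multiple_mult_left:
  assumes "q \<noteq> 0" "z_multiple q s"
  shows "z_multiple q (rep q r * s)"
proof -
  obtain t where t: "t \<in> weyl_alg q" "s = z_op q * t"
    using assms(2) by (auto simp: z_multiple_def)
  then obtain u where "t = rep q u" by (auto simp: weyl_alg_def)
  with t show ?thesis
    using z_multiple_mult_right[OF rep_z_commute[OF assms(1)], of r u] by (simp add: mult.assoc)
qed

text \<open>
  The algebra is commutative modulo \<open>z\<close>, because \<open>XY\<close> and \<open>YX\<close> differ by
  \<open>z\<close>; the elements commuting with a generator modulo \<open>z\<close> form a subalgebra.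
\<close>

lemma commutator_z_multiple:
  assumes "q \<noteq> 0" "q \<noteq> 1"
  shows "z_multiple q (rep q p * weyl_op q x - weyl_op q x * rep q p)"
proof (induction p rule: free_algebra_induct)
  case (const c)
  show ?case
    using const_rep_commute[of q c "free_gen x"] weyl_alg_0[of q]
    by (auto simp: z_multiple_def intro: bexI[of _ 0])
next
  case (gen y)
  have z: "lower q * shift - shift * lower q = z_op q"
    using rep_free_z[OF assms(2)] by (simp add: free_z_def rep_diff rep_mult)
  then have z': "shift * lower q - lower q * shift = - z_op q"
    by (metis minus_diff_eq)
  have 1: "z_multiple q (z_op q)"
    unfolding z_multiple_def by (rule bexI[of _ 1]) (use weyl_alg_rep[of q 1] in auto)
  have 0: "z_multiple q 0"
    unfolding z_multiple_def by (rule bexI[of _ 0]) (use weyl_alg_0[of q] in auto)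
  show ?case
    using z z' 0 1 z_multiple_uminus[OF 1] by (cases x; cases y) simp_all
next
  case (add p r)
  then show ?case
    using z_multiple_add[OF add] by (simp add: rep_add algebra_simps)
next
  case (mult p r)
  have "rep q (p * r) * weyl_op q x - weyl_op q x * rep q (p * r)
    = rep q p * (rep q r * weyl_op q x - weyl_op q x * rep q r)
    + (rep q p * weyl_op q x - weyl_op q x * rep q p) * rep q r"
    by (simp add: rep_mult algebra_simps)
  then show ?case
    using mult by (simp add: z_multiple_add z_multiple_mult_left[OF assms(1)] z_multiple_mult_right)
qed

section \<open>Commutation with z and the grading\<close>

lemma weyl_pow_z:
  assumes "q \<noteq> 0"
  shows "weyl_pow q n * z_op q = pol q [:q powi (- n):] * z_op q * weyl_pow q n"
proof -
  have X: "shift ^ m * z_op q = pol q [:inverse q ^ m:] * z_op q * shift ^ m" for m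
  proof (induction m)
    case (Suc m)
    have "shift ^ Suc m * z_op q = shift * (shift ^ m * z_op q)"
      by (simp add: mult.assoc)
    also have "\<dots> = pol q [:inverse q ^ m:] * (shift * z_op q) * shift ^ m"
      by (simp only: Suc mult.assoc[symmetric] pol_const_commute)
    also have "\<dots> = pol q ([:inverse q ^ m:] * [:inverse q:]) * z_op q * shift ^ Suc m"
      by (simp only: shift_z[OF assms] pol_mult mult.assoc power_Suc)
    finally show ?case by (simp add: mult.commute)
  qed (simp flip: one_pCons)
  have Y: "lower q ^ m * z_op q = pol q [:q ^ m:] * z_op q * lower q ^ m" for m
  proof (induction m)
    case (Suc m)
    have "lower q ^ Suc m * z_op q = lower q * (lower q ^ m * z_op q)"
      by (simp add: mult.assoc)
    also have "\<dots> = pol q [:q ^ m:] * (lower q * z_op q) * lower q ^ m"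
      by (simp only: Suc mult.assoc[symmetric] pol_const_commute)
    also have "\<dots> = pol q ([:q ^ m:] * [:q:]) * z_op q * lower q ^ Suc m"
      by (simp only: lower_z pol_mult mult.assoc power_Suc)
    finally show ?case by (simp add: mult.commute)
  qed (simp flip: one_pCons)
  show ?thesis
    using X[of "nat n"] Y[of "nat (- n)"]
    by (cases "0 \<le> n") (auto simp: weyl_pow_def grade_power_def power_int_def)
qed

lemma (in non_root) q_powi_eq_iff:
  "q powi m = q powi n \<longleftrightarrow> m = n"
proof -
  have *: "q powi k \<noteq> 1" if "k > 0" for k
    using q_power[rule_format, of "nat k"] that by (simp add: power_int_def)
  have "m = n" if "q powi m = q powi n" for m n
  proof (rule ccontr)
    assume "m \<noteq> n"
    moreover have "q powi (m - n) = 1" "q powi (n - m) = 1"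
      using that q_nonzero by (simp_all add: power_int_diff)
    ultimately show False using *[of "m - n"] *[of "n - m"] by linarith
  qed
  then show ?thesis by blast
qed

text \<open>
  On the component of degree \<open>n\<close>, right multiplication by \<open>z\<close> is \<open>q\<^sup>-\<^sup>n\<close>
  times left multiplication.
\<close>

lemma laurent_z_commutator:
  assumes "q \<noteq> 0"
  shows "\<exists>f'. (\<forall>n. Poly_Mapping.lookup f' n = [:0, q powi (- n) - c:] * Poly_Mapping.lookup f n) \<and>
    laurent q f * z_op q - pol q [:c:] * z_op q * laurent q f = laurent q f'"
proof (induction f rule: poly_mapping_add_induct)
  case (single n h)
  have "pol q h * weyl_pow q n * z_op q - pol q [:c:] * z_op q * (pol q h * weyl_pow q n)
    = pol q (h * [:q powi (- n):] * [:0, 1:]) * weyl_pow q n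
    - pol q ([:c:] * [:0, 1:] * h) * weyl_pow q n"
    by (simp only: mult.assoc weyl_pow_z[OF assms] pol_mult)
  also have "\<dots> = pol q (h * [:q powi (- n):] * [:0, 1:] - [:c:] * [:0, 1:] * h) * weyl_pow q n"
    by (simp only: pol_diff left_diff_distrib)
  also have "h * [:q powi (- n):] * [:0, 1:] - [:c:] * [:0, 1:] * h
      = h * ([:q powi (- n):] * [:0, 1:] - [:c:] * [:0, 1:])"
    by (simp only: algebra_simps)
  also have "[:q powi (- n):] * [:0, 1:] - [:c:] * [:0, 1:] = [:0, q powi (- n) - c:]"
    by simp
  finally show ?case
    by (intro exI[of _ "Poly_Mapping.single n ([:0, q powi (- n) - c:] * h)"])
      (simp only: laurent_single lookup_single mult.commute when_def, simp)
next
  case (add f g)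
  then obtain f' g' where *:
    "\<And>n. Poly_Mapping.lookup f' n = [:0, q powi (- n) - c:] * Poly_Mapping.lookup f n"
    "\<And>n. Poly_Mapping.lookup g' n = [:0, q powi (- n) - c:] * Poly_Mapping.lookup g n"
    and **: "laurent q f * z_op q - pol q [:c:] * z_op q * laurent q f = laurent q f'"
    "laurent q g * z_op q - pol q [:c:] * z_op q * laurent q g = laurent q g'"
    by blast
  have "laurent q (f + g) * z_op q - pol q [:c:] * z_op q * laurent q (f + g)
      = laurent q (f' + g')"
    by (simp add: laurent_add algebra_simps flip: **)
  moreover have "Poly_Mapping.lookup (f' + g') n
      = [:0, q powi (- n) - c:] * Poly_Mapping.lookup (f + g) n" for n
    by (simp only: lookup_add distrib_left *)
  ultimately show ?case by blast
qed

text \<open>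
  The operator \<open>s \<mapsto> sz - q\<^sup>-\<^sup>m zs\<close> kills exactly the component of degree \<open>m\<close>
  and multiplies every other component by a nonzero multiple of \<open>z\<close>. So an image of degree
  \<open>m\<close> must be zero, and its preimage is homogeneous of degree \<open>m\<close>.
\<close>

lemma (in non_root) z_eigenvector:
  assumes s: "s \<in> weyl_alg q"
    and eq: "s * z_op q - pol q [:q powi (- m):] * z_op q * s = pol q g * weyl_pow q m"
  shows "g = 0 \<and> (\<exists>h. s = pol q h * weyl_pow q m)"
proof -
  obtain f where f: "s = laurent q f"
    using s rep_laurent_cases[OF q_nonzero q_neq_1] by (auto simp: weyl_alg_def)
  obtain f' where f': "\<And>n. Poly_Mapping.lookup f' n
      = [:0, q powi (- n) - q powi (- m):] * Poly_Mapping.lookup f n"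
    "s * z_op q - pol q [:q powi (- m):] * z_op q * s = laurent q f'"
    using laurent_z_commutator[OF q_nonzero, of "q powi (- m)" f] unfolding f by blast
  have "laurent q (f' - Poly_Mapping.single m g) = 0"
    using f'(2) eq by (simp add: laurent_diff laurent_single)
  then have "f' - Poly_Mapping.single m g = 0" by (rule laurent_eq_0)
  then have f'': "f' = Poly_Mapping.single m g" by simp
  have "g = 0"
    using f'(1)[of m] by (simp add: f'')
  moreover have "Poly_Mapping.lookup f n = 0" if "n \<noteq> m" for n
  proof -
    have "[:0, q powi (- n) - q powi (- m):] \<noteq> 0"
      using that q_powi_eq_iff[of "- n" "- m"] by simp
    then show ?thesis
      using f'(1)[of n] that by (simp add: f'' lookup_single del: mult_pCons_left)
  qed
  then have "f = Poly_Mapping.single m (Poly_Mapping.lookup f m)"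
    by (intro poly_mapping_eqI) (simp add: lookup_single when_def)
  then have "s = pol q (Poly_Mapping.lookup f m) * weyl_pow q m"
    by (metis f laurent_single)
  ultimately show ?thesis by blast
qed

text \<open>
  Bracketing with \<open>z\<close> multiplies a component of degree \<open>n \<noteq> 0\<close> by
  \<open>(q\<^sup>-\<^sup>n - 1) z\<close>, with nonzero scalar. It therefore reaches every multiple of \<open>z\<close>
  except in degree \<open>0\<close>.
\<close>

lemma (in non_root) z_multiple_inner:
  assumes "z_multiple q s"
  shows "\<exists>w\<in>weyl_alg q. \<exists>g. s = w * z_op q - z_op q * w + pol q g"
proof -
  obtain p where "s = z_op q * rep q p"
    using assms by (auto simp: z_multiple_def weyl_alg_def)
  moreover obtain f where "rep q p = laurent q f"
    by (rule rep_laurent_cases[OF q_nonzero q_neq_1])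
  moreover have "\<exists>w\<in>weyl_alg q. \<exists>g. z_op q * laurent q f = w * z_op q - z_op q * w + pol q g"
  proof (induction f rule: poly_mapping_add_induct)
    case (single n h)
    show ?case
    proof (cases "n = 0")
      case True
      then show ?thesis
        by (intro bexI[of _ 0] exI[of _ "[:0, 1:] * h"])
          (simp_all add: laurent_single weyl_pow_def grade_power_def weyl_alg_0 pol_mult
            del: mult_pCons_left)
    next
      case False
      define e where "e = q powi (- n)"
      define t where "t = pol q h * weyl_pow q n"
      define w where "w = pol q [:inverse (e - 1):] * t"
      have "e \<noteq> 1"
        using False q_powi_eq_iff[of "- n" 0] by (simp add: e_def)
      then have "inverse (e - 1) * (e - 1) = 1" by simp
      then have i: "inverse (e - 1) * e = 1 + inverse (e - 1)"
        by (simp only: right_diff_distrib mult_1_right diff_eq_eq)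
      have t: "t * z_op q = pol q [:e:] * z_op q * t"
      proof -
        have "t * z_op q = pol q h * (pol q [:e:] * z_op q) * weyl_pow q n"
          by (simp only: t_def mult.assoc weyl_pow_z[OF q_nonzero] e_def)
        then show ?thesis
          by (simp only: t_def mult.assoc pol_mult[symmetric] mult.commute[of h])
            (simp only: pol_mult mult.assoc)
      qed
      have "w * z_op q - z_op q * w
          = pol q ([:inverse (e - 1):] * [:e:] * [:0, 1:]) * t
          - pol q ([:0, 1:] * [:inverse (e - 1):]) * t"
        by (simp only: w_def mult.assoc t pol_mult)
      also have "\<dots> = pol q ([:inverse (e - 1):] * [:e:] * [:0, 1:]
          - [:0, 1:] * [:inverse (e - 1):]) * t"
        by (simp only: pol_diff left_diff_distrib)
      also have "[:inverse (e - 1):] * [:e:] * [:0, 1:] - [:0, 1:] * [:inverse (e - 1):] = [:0, 1:]"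
        by (simp add: mult.commute[of e] i)
      finally have "z_op q * laurent q (Poly_Mapping.single n h) = w * z_op q - z_op q * w + pol q 0"
        by (simp add: laurent_single t_def)
      moreover have "w \<in> weyl_alg q"
        unfolding w_def t_def
        by (intro weyl_alg_mult weyl_alg_pol q_neq_1)
          (metis rep_grade_power weyl_alg_rep)
      ultimately show ?thesis by blast
    qed
  next
    case (add f g)
    then obtain w a v b where "w \<in> weyl_alg q" "v \<in> weyl_alg q"
      "z_op q * laurent q f = w * z_op q - z_op q * w + pol q a"
      "z_op q * laurent q g = v * z_op q - z_op q * v + pol q b"
      by blast
    then show ?case
      by (intro bexI[of _ "w + v"] exI[of _ "a + b"])
        (simp_all add: laurent_add pol_add distrib_left distrib_right weyl_alg_add)
  qed
  ultimately show ?thesis by simp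
qed

section \<open>Derivations along the representation\<close>

text \<open>
  A derivation of the quotient is studied through its composites with the projection from the free
  algebra and with the representation. The result is a map out of a type with ring operations that
  satisfies the Leibniz rule with respect to \<^const>\<open>rep\<close>.
\<close>

definition rep_der :: "'k::field \<Rightarrow> ((weyl_letter monomial \<Rightarrow>\<^sub>0 'k) \<Rightarrow> 'k seq_endo) \<Rightarrow> bool"
  where "rep_der q \<Delta> \<longleftrightarrow>
    (\<forall>p r. \<Delta> (p + r) = \<Delta> p + \<Delta> r) \<and>
    (\<forall>p r. \<Delta> (p * r) = \<Delta> p * rep q r + rep q p * \<Delta> r) \<and>
    (\<forall>c. \<Delta> (const c) = 0)"

lemma rep_der_simps:
  assumes "rep_der q \<Delta>"
  shows "\<Delta> (p + r) = \<Delta> p + \<Delta> r"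
    and "\<Delta> (p * r) = \<Delta> p * rep q r + rep q p * \<Delta> r"
    and "\<Delta> (const c) = 0" and "\<Delta> 1 = 0"
    and "\<Delta> (p - r) = \<Delta> p - \<Delta> r"
proof -
  show add: "\<Delta> (p + r) = \<Delta> p + \<Delta> r" for p r using assms by (simp add: rep_der_def)
  show "\<Delta> (p * r) = \<Delta> p * rep q r + rep q p * \<Delta> r" using assms by (simp add: rep_der_def)
  show c: "\<Delta> (const c) = 0" for c using assms by (simp add: rep_der_def)
  show "\<Delta> 1 = 0" using c[of 1] by simp
  show "\<Delta> (p - r) = \<Delta> p - \<Delta> r" using add[of "p - r" r] by (simp add: algebra_simps)
qed

definition bracket :: "'r::ring \<Rightarrow> 'r \<Rightarrow> 'r"
  where "bracket w s = w * s - s * w"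

lemma rep_der_bracket:
  assumes "\<And>c. w * pol q [:c:] = pol q [:c:] * w"
  shows "rep_der q (\<lambda>p. bracket w (rep q p))"
  using assms by (simp add: rep_der_def bracket_def rep_add rep_mult algebra_simps)

lemma rep_der_bracket_alg: "w \<in> weyl_alg q \<Longrightarrow> rep_der q (\<lambda>p. bracket w (rep q p))"
  by (rule rep_der_bracket) (rule weyl_alg_const_commute)

lemma rep_der_euler: "rep_der q (\<lambda>p. bracket euler (rep q p))"
  by (rule rep_der_bracket) (rule euler_pol)

lemma rep_der_diff: "rep_der q \<Delta> \<Longrightarrow> rep_der q E \<Longrightarrow> rep_der q (\<lambda>p. \<Delta> p - E p)"
  by (simp add: rep_der_def algebra_simps)

lemma rep_der_add: "rep_der q \<Delta> \<Longrightarrow> rep_der q E \<Longrightarrow> rep_der q (\<lambda>p. \<Delta> p + E p)"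
  by (simp add: rep_der_def algebra_simps)

lemma rep_der_scale:
  assumes "rep_der q \<Delta>"
  shows "rep_der q (\<lambda>p. pol q [:c:] * \<Delta> p)"
proof -
  have "rep q p * (pol q [:c:] * s) = pol q [:c:] * (rep q p * s)" for p s
    by (simp only: mult.assoc[symmetric] const_rep_commute)
  then show ?thesis
    using assms by (simp add: rep_der_def algebra_simps)
qed

lemma rep_der_eqI:
  assumes "rep_der q \<Delta>" "rep_der q E" "\<And>x. \<Delta> (free_gen x) = E (free_gen x)"
  shows "\<Delta> p = E p"
  by (induction p rule: free_algebra_induct)
    (simp_all add: assms(3) rep_der_simps[OF assms(1)] rep_der_simps[OF assms(2)])

lemma bracket_euler_mem: "bracket euler (rep q p) \<in> weyl_alg q"
proof (induction p rule: free_algebra_induct)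
  case (const c)
  show ?case by (simp add: bracket_def euler_pol weyl_alg_0)
next
  case (gen x)
  show ?case
    using weyl_alg_rep[of q "free_gen LX"] weyl_alg_rep[of q "- free_gen LY"]
      rep_diff[of q 0 "free_gen LY"]
    by (cases x) (simp_all add: bracket_def euler_shift euler_lower)
qed (simp_all add: rep_der_simps[OF rep_der_euler] weyl_alg_add weyl_alg_mult weyl_alg_rep)

lemma (in non_root) pol_mult_right_cancel:
  assumes "pol q f * weyl_pow q n = pol q g * weyl_pow q n"
  shows "f = g"
proof -
  have "laurent q (Poly_Mapping.single n (f - g)) = 0"
    using assms by (simp add: laurent_single pol_diff left_diff_distrib)
  then have "Poly_Mapping.single n (f - g) = 0"
    by (rule laurent_eq_0)
  then have "Poly_Mapping.lookup (Poly_Mapping.single n (f - g)) n = 0"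
    by simp
  then show ?thesis by simp
qed

lemma (in non_root) pol_inj:
  assumes "pol q f = pol q g"
  shows "f = g"
  using pol_mult_right_cancel[of f 0 g] assms by simp

lemma weyl_pow_pm1: "weyl_pow q 1 = shift" "weyl_pow q (- 1) = lower q" "weyl_pow q 0 = 1"
  by (simp_all add: weyl_pow_def grade_power_def)

text \<open>
  The map \<open>u(z) \<mapsto> u(z) - u(q\<^sup>-\<^sup>1 z)\<close> multiplies the coefficient of \<open>z\<^sup>i\<close> by
  \<open>1 - q\<^sup>-\<^sup>i\<close>, so only constants are missing from its image.
\<close>

lemma (in non_root) q_difference_equation:
  "\<exists>u c. f = [:c:] + (u - u \<circ>\<^sub>p [:0, inverse q:])"
proof -
  define u where "u = (\<Sum>i\<le>degree f. monom (if i = 0 then 0 else coeff f i / (1 - inverse q ^ i)) i)"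
  have u: "coeff u i = (if i = 0 then 0 else coeff f i / (1 - inverse q ^ i))" for i
    by (simp add: u_def coeff_sum coeff_eq_0)
  have *: "coeff u i - inverse q ^ i * coeff u i = coeff f i" if "i \<noteq> 0" for i
  proof -
    have "1 - inverse q ^ i \<noteq> 0"
      using q_power that by (simp add: power_inverse)
    moreover have "coeff u i - inverse q ^ i * coeff u i = (1 - inverse q ^ i) * coeff u i"
      by (simp add: left_diff_distrib)
    ultimately show ?thesis using that by (simp add: u)
  qed
  have "f = [:coeff f 0:] + (u - u \<circ>\<^sub>p [:0, inverse q:])"
  proof (intro poly_eqI)
    fix n
    show "coeff f n = coeff ([:coeff f 0:] + (u - u \<circ>\<^sub>p [:0, inverse q:])) n"
      using *[of n] by (cases n) (simp_all add: coeff_pcompose_linear poly_0_coeff_0)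
  qed
  then show ?thesis by blast
qed

lemma rep_der_cong:
  assumes "rep_der q \<Delta>" "weyl_cong q p r" "\<And>p. p \<in> weyl_ideal q \<Longrightarrow> \<Delta> p = 0"
  shows "\<Delta> p = \<Delta> r"
  using assms rep_der_simps(5)[OF assms(1), of p r] by (simp add: weyl_cong_def)

text \<open>
  The relations \<open>Xz = q\<^sup>-\<^sup>1 zX\<close> and \<open>Yz = q zY\<close> force the images of \<open>X\<close> and
  \<open>Y\<close> to be \<open>f(z) X\<close> and \<open>h(z) Y\<close>, and \<open>\<Delta> z = \<lambda> z\<close> for a scalar. Applying
  the derivation to \<open>YX = (qz - 1)/(q - 1)\<close> gives
  \<open>(h(z) + f(qz)) (qz - 1) = q \<lambda> z\<close>, and putting \<open>z = q\<^sup>-\<^sup>1\<close> gives \<open>\<lambda> = 0\<close>. Then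
  \<open>h(z) = -f(qz)\<close>, and solving \<open>f(z) = c + u(z) - u(q\<^sup>-\<^sup>1 z)\<close> exhibits the derivation as
  the commutator with \<open>u(z)\<close> plus \<open>c H\<close>.
\<close>

lemma (in non_root) rep_der_grade0:
  assumes \<Delta>: "rep_der q \<Delta>" "\<And>p. p \<in> weyl_ideal q \<Longrightarrow> \<Delta> p = 0" "\<And>p. \<Delta> p \<in> weyl_alg q"
    and z: "\<Delta> free_z = pol q G"
  shows "\<exists>u c. \<Delta> (free_gen LX) = bracket (pol q u) shift + pol q [:c:] * shift \<and>
    \<Delta> (free_gen LY) = bracket (pol q u) (lower q) - pol q [:c:] * lower q"
proof -
  let ?X = "free_gen LX :: weyl_letter monomial \<Rightarrow>\<^sub>0 'k"
  let ?Y = "free_gen LY :: weyl_letter monomial \<Rightarrow>\<^sub>0 'k"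
  note der = rep_der_simps[OF \<Delta>(1)] and cong = rep_der_cong[OF \<Delta>(1) _ \<Delta>(2)]
  have "\<Delta> (?X * free_z) = \<Delta> (const (inverse q) * (free_z * ?X))"
    by (rule cong[OF Xz_cong[OF q_nonzero]])
  then have "\<Delta> ?X * z_op q - pol q [:inverse q:] * z_op q * \<Delta> ?X
      = pol q [:inverse q:] * pol q G * shift - shift * pol q G"
    by (simp add: der z rep_free_z[OF q_neq_1] algebra_simps)
  also have "\<dots> = pol q ([:inverse q:] * G - G \<circ>\<^sub>p [:0, inverse q:]) * shift"
    by (simp only: pol_shift[OF q_nonzero] pol_mult pol_diff left_diff_distrib)
  finally have "\<Delta> ?X * z_op q - pol q [:q powi (- 1):] * z_op q * \<Delta> ?X
      = pol q ([:inverse q:] * G - G \<circ>\<^sub>p [:0, inverse q:]) * weyl_pow q 1"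
    by (simp add: weyl_pow_pm1 power_int_minus)
  from z_eigenvector[OF \<Delta>(3) this] obtain f
    where G: "[:inverse q:] * G = G \<circ>\<^sub>p [:0, inverse q:]" and f: "\<Delta> ?X = pol q f * shift"
    by (auto simp: weyl_pow_pm1)
  have "\<Delta> (?Y * free_z) = \<Delta> (const q * (free_z * ?Y))"
    by (rule cong[OF Yz_cong])
  then have "\<Delta> ?Y * z_op q - pol q [:q:] * z_op q * \<Delta> ?Y
      = pol q [:q:] * pol q G * lower q - lower q * pol q G"
    by (simp add: der z rep_free_z[OF q_neq_1] algebra_simps)
  also have "\<dots> = pol q ([:q:] * G - G \<circ>\<^sub>p [:0, q:]) * lower q"
    by (simp only: lower_pol pol_mult pol_diff left_diff_distrib)
  finally have "\<Delta> ?Y * z_op q - pol q [:q powi (- (- 1)):] * z_op q * \<Delta> ?Y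
      = pol q ([:q:] * G - G \<circ>\<^sub>p [:0, q:]) * weyl_pow q (- 1)"
    by (simp add: weyl_pow_pm1)
  from z_eigenvector[OF \<Delta>(3) this] obtain h where h: "\<Delta> ?Y = pol q h * lower q"
    by (auto simp: weyl_pow_pm1)
  \<comment> \<open>The rescaling identity for \<open>G\<close> leaves only its linear coefficient.\<close>
  have G_coeff: "coeff G k = 0" if "k \<noteq> 1" for k
  proof -
    have "inverse q * coeff G k = inverse q ^ k * coeff G k"
      using arg_cong[OF G, of "\<lambda>p. coeff p k"] by (simp add: coeff_pcompose_linear)
    moreover have "inverse q \<noteq> inverse q ^ k"
      using q_powi_eq_iff[of 1 "int k"] that by (simp add: power_inverse)
    ultimately show ?thesis by simp
  qed
  define i where "i = inverse (q - 1)"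
  have "i \<noteq> 0" using q_neq_1 by (simp add: i_def)
  let ?N = "[:-1, q:] * [:i:]"
  have "\<Delta> (?Y * ?X) = \<Delta> (const i * (const q * free_z - 1))"
    unfolding i_def by (rule cong[OF XY_YX_cong(2)[OF q_neq_1]])
  also have "\<dots> = pol q ([:i:] * ([:q:] * G))"
    by (simp only: der rep_const z pol_mult mult_zero_left add_0 diff_zero)
  also have "\<Delta> (?Y * ?X) = pol q h * (lower q * shift) + (lower q * pol q f) * shift"
    by (simp add: der f h mult.assoc)
  also have "\<dots> = pol q h * (lower q * shift) + pol q (f \<circ>\<^sub>p [:0, q:]) * (lower q * shift)"
    by (simp only: lower_pol mult.assoc)
  also have "\<dots> = pol q ((h + f \<circ>\<^sub>p [:0, q:]) * ?N)"
    by (simp only: lower_shift i_def pol_mult pol_add distrib_right)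
  finally have rel: "(h + f \<circ>\<^sub>p [:0, q:]) * ?N = [:i:] * ([:q:] * G)"
    by (rule pol_inj)
  \<comment> \<open>The factor \<open>qz - 1\<close> on the left vanishes at \<open>q\<^sup>-\<^sup>1\<close>.\<close>
  have "poly ([:i:] * ([:q:] * G)) (inverse q) = 0"
    unfolding rel[symmetric] using q_nonzero by simp
  then have "poly G (inverse q) = 0"
    using q_nonzero \<open>i \<noteq> 0\<close> by simp
  moreover obtain l where l: "G = monom l 1"
  proof
    show "G = monom (coeff G 1) 1"
      using G_coeff by (intro poly_eqI) auto
  qed
  ultimately have "G = 0"
    using q_nonzero by (simp add: l poly_monom)
  then have "(h + f \<circ>\<^sub>p [:0, q:]) * ?N = 0"
    using rel by simp
  moreover have "?N \<noteq> 0" using \<open>i \<noteq> 0\<close> q_nonzero by simp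
  ultimately have hf: "h = - (f \<circ>\<^sub>p [:0, q:])"
    by (simp only: mult_eq_0_iff add_eq_0_iff2) simp
  obtain u c where u: "f = [:c:] + (u - u \<circ>\<^sub>p [:0, inverse q:])"
    using q_difference_equation by blast
  have "\<Delta> ?X = bracket (pol q u) shift + pol q [:c:] * shift"
    unfolding f u bracket_def pol_shift[OF q_nonzero] by (simp only: pol_add pol_diff) (simp add: algebra_simps)
  moreover have "(u \<circ>\<^sub>p [:0, inverse q:]) \<circ>\<^sub>p [:0, q:] = u"
    using q_nonzero by (simp flip: pcompose_assoc add: pcompose_pCons)
  then have "h = u - u \<circ>\<^sub>p [:0, q:] - [:c:]"
    unfolding hf u by (simp add: pcompose_add pcompose_diff)
  then have "\<Delta> ?Y = bracket (pol q u) (lower q) - pol q [:c:] * lower q"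
    unfolding h bracket_def lower_pol by (simp only: pol_diff) (simp add: algebra_simps)
  ultimately show ?thesis by blast
qed

text \<open>
  The image of \<open>z = YX - XY\<close> is a sum of two commutators with generators, hence a multiple of
  \<open>z\<close>; subtracting an inner derivation moves it into degree \<open>0\<close>.
\<close>

lemma (in non_root) rep_der_decomposition:
  assumes \<Delta>: "rep_der q \<Delta>" "\<And>p. p \<in> weyl_ideal q \<Longrightarrow> \<Delta> p = 0" "\<And>p. \<Delta> p \<in> weyl_alg q"
  shows "\<exists>w\<in>weyl_alg q. \<exists>c. \<forall>p. \<Delta> p = bracket w (rep q p) + pol q [:c:] * bracket euler (rep q p)"
proof -
  let ?X = "free_gen LX :: weyl_letter monomial \<Rightarrow>\<^sub>0 'k"
  let ?Y = "free_gen LY :: weyl_letter monomial \<Rightarrow>\<^sub>0 'k"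
  obtain a b where a: "\<Delta> ?Y = rep q a" and b: "\<Delta> ?X = rep q b"
    using \<Delta>(3)[of ?X] \<Delta>(3)[of ?Y] by (auto simp: weyl_alg_def)
  have "\<Delta> free_z = (rep q a * weyl_op q LX - weyl_op q LX * rep q a)
      - (rep q b * weyl_op q LY - weyl_op q LY * rep q b)"
    unfolding free_z_def by (simp add: rep_der_simps[OF \<Delta>(1)] a b)
  also have "z_multiple q \<dots>"
    unfolding diff_conv_add_uminus[of "_ - _"]
    by (intro z_multiple_add z_multiple_uminus commutator_z_multiple q_nonzero q_neq_1)
  finally obtain w G where w: "w \<in> weyl_alg q"
    and G: "\<Delta> free_z = w * z_op q - z_op q * w + pol q G"
    using z_multiple_inner by blast
  define \<Delta>' where "\<Delta>' = (\<lambda>p. \<Delta> p - bracket w (rep q p))"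
  have \<Delta>': "rep_der q \<Delta>'" "\<And>p. p \<in> weyl_ideal q \<Longrightarrow> \<Delta>' p = 0" "\<And>p. \<Delta>' p \<in> weyl_alg q"
    unfolding \<Delta>'_def
      apply (rule rep_der_diff[OF \<Delta>(1) rep_der_bracket_alg[OF w]])
     apply (simp add: \<Delta>(2) rep_weyl_ideal[OF q_neq_1] bracket_def)
    apply (simp add: \<Delta>(3) bracket_def weyl_alg_diff weyl_alg_mult weyl_alg_rep w)
    done
  have "\<Delta>' free_z = pol q G"
    by (simp add: \<Delta>'_def G bracket_def rep_free_z[OF q_neq_1])
  from rep_der_grade0[OF \<Delta>' this] obtain u c
    where uX: "\<Delta>' ?X = bracket (pol q u) shift + pol q [:c:] * shift"
      and uY: "\<Delta>' ?Y = bracket (pol q u) (lower q) - pol q [:c:] * lower q"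
    by blast
  have u: "pol q u \<in> weyl_alg q" by (rule weyl_alg_pol[OF q_neq_1])
  have "\<Delta>' p = bracket (pol q u) (rep q p) + pol q [:c:] * bracket euler (rep q p)" for p
  proof (rule rep_der_eqI[OF \<Delta>'(1)])
    show "rep_der q (\<lambda>p. bracket (pol q u) (rep q p) + pol q [:c:] * bracket euler (rep q p))"
      by (intro rep_der_add rep_der_scale rep_der_bracket_alg u rep_der_euler)
    show "\<Delta>' (free_gen x) = bracket (pol q u) (rep q (free_gen x))
        + pol q [:c:] * bracket euler (rep q (free_gen x))" for x
      by (cases x) (simp_all add: uX uY bracket_def[of euler] euler_shift euler_lower)
  qed
  then have "\<Delta> p = bracket w (rep q p) + bracket (pol q u) (rep q p)
      + pol q [:c:] * bracket euler (rep q p)" for p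
    by (simp add: \<Delta>'_def diff_eq_eq add_ac)
  moreover have "bracket w s + bracket (pol q u) s = bracket (w + pol q u) s" for s
    by (simp add: bracket_def algebra_simps)
  ultimately have "\<Delta> p = bracket (w + pol q u) (rep q p) + pol q [:c:] * bracket euler (rep q p)" for p
    by simp
  then show ?thesis
    using weyl_alg_add[OF w u] by blast
qed

text \<open>
  As \<open>H\<close> kills \<open>z\<close>, an element \<open>w\<close> inducing \<open>c H\<close> commutes with \<open>z\<close> and
  has the form \<open>f(z)\<close>. Comparing the values on \<open>X\<close> gives \<open>f(z) - f(q\<^sup>-\<^sup>1 z) = c\<close>, whose
  left side has no constant term.
\<close>

lemma (in non_root) euler_not_inner:
  assumes w: "w \<in> weyl_alg q"
    and eq: "\<And>p. bracket w (rep q p) = pol q [:c:] * bracket euler (rep q p)"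
  shows "c = 0"
proof -
  have "w * z_op q - z_op q * w = 0"
    using eq[of free_z] by (simp add: rep_free_z[OF q_neq_1] bracket_def euler_pol)
  then have "w * z_op q - pol q [:q powi (- 0):] * z_op q * w = pol q 0 * weyl_pow q 0"
    by (simp flip: one_pCons)
  from z_eigenvector[OF w this] obtain f where f: "w = pol q f"
    by (auto simp: weyl_pow_pm1)
  have "bracket w shift = pol q [:c:] * shift"
    using eq[of "free_gen LX"] by (simp add: bracket_def[of euler] euler_shift)
  then have "pol q (f - f \<circ>\<^sub>p [:0, inverse q:]) * weyl_pow q 1 = pol q [:c:] * weyl_pow q 1"
    by (simp add: f bracket_def pol_shift[OF q_nonzero] weyl_pow_pm1 pol_diff left_diff_distrib)
  then have "f - f \<circ>\<^sub>p [:0, inverse q:] = [:c:]"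
    by (rule pol_mult_right_cancel)
  then have "coeff (f - f \<circ>\<^sub>p [:0, inverse q:]) 0 = c"
    by simp
  then show ?thesis by (simp add: coeff_pcompose_linear poly_0_coeff_0)
qed

section \<open>The space of derivations of an algebra\<close>

locale k_algebra = ring A for A :: "('k::field, 'a) module" (structure) +
  assumes smult_closed [simp]: "a \<in> carrier A \<Longrightarrow> c \<odot> a \<in> carrier A"
    and smult_l_distr: "a \<in> carrier A \<Longrightarrow> (c + d) \<odot> a = c \<odot> a \<oplus> d \<odot> a"
    and smult_r_distr: "a \<in> carrier A \<Longrightarrow> b \<in> carrier A \<Longrightarrow> c \<odot> (a \<oplus> b) = c \<odot> a \<oplus> c \<odot> b"
    and smult_assoc: "a \<in> carrier A \<Longrightarrow> (c * d) \<odot> a = c \<odot> (d \<odot> a)"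
    and smult_one [simp]: "a \<in> carrier A \<Longrightarrow> 1 \<odot> a = a"
    and smult_mult_left: "a \<in> carrier A \<Longrightarrow> b \<in> carrier A \<Longrightarrow> (c \<odot> a) \<otimes> b = c \<odot> (a \<otimes> b)"
    and smult_mult_right: "a \<in> carrier A \<Longrightarrow> b \<in> carrier A \<Longrightarrow> a \<otimes> (c \<odot> b) = c \<odot> (a \<otimes> b)"
begin

lemma smult_zero_left: "a \<in> carrier A \<Longrightarrow> 0 \<odot> a = \<zero>"
proof -
  assume a: "a \<in> carrier A"
  then have "0 \<odot> a \<oplus> 0 \<odot> a = 0 \<odot> a"
    by (simp flip: smult_l_distr)
  with a show "0 \<odot> a = \<zero>" by (simp only: add.l_cancel_one smult_closed)
qed

lemma smult_zero_right: "c \<odot> \<zero> = \<zero>"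
proof -
  have "c \<odot> \<zero> \<oplus> c \<odot> \<zero> = c \<odot> \<zero>"
    by (simp flip: smult_r_distr)
  then show ?thesis by (simp only: add.l_cancel_one smult_closed zero_closed)
qed

lemma smult_minus_one:
  assumes a: "a \<in> carrier A"
  shows "(- 1) \<odot> a = \<ominus> a"
proof -
  have "(- 1) \<odot> a \<oplus> a = (- 1 + 1) \<odot> a"
    by (simp only: smult_l_distr[OF a] smult_one[OF a])
  then have "(- 1) \<odot> a \<oplus> a = \<zero>"
    by (simp only: add.left_inverse smult_zero_left[OF a])
  then show ?thesis
    by (rule minus_equality[symmetric]) (simp_all add: a)
qed

lemma smult_diff: "a \<in> carrier A \<Longrightarrow> b \<in> carrier A \<Longrightarrow> c \<odot> (a \<ominus> b) = c \<odot> a \<ominus> c \<odot> b"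
  by (simp add: a_minus_def smult_r_distr flip: smult_minus_one smult_assoc)

lemma DerD:
  assumes "D \<in> Der A"
  shows Der_closed: "a \<in> carrier A \<Longrightarrow> D a \<in> carrier A"
    and Der_ext: "a \<notin> carrier A \<Longrightarrow> D a = undefined"
    and Der_add: "a \<in> carrier A \<Longrightarrow> b \<in> carrier A \<Longrightarrow> D (a \<oplus> b) = D a \<oplus> D b"
    and Der_smult: "a \<in> carrier A \<Longrightarrow> D (c \<odot> a) = c \<odot> D a"
    and Der_mult: "a \<in> carrier A \<Longrightarrow> b \<in> carrier A \<Longrightarrow> D (a \<otimes> b) = D a \<otimes> b \<oplus> a \<otimes> D b"
  using assms unfolding Der_def PiE_iff extensional_def by blast+

lemma Der_eqI:
  "D \<in> Der A \<Longrightarrow> E \<in> Der A \<Longrightarrow> (\<And>a. a \<in> carrier A \<Longrightarrow> D a = E a) \<Longrightarrow> D = E"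
  by (rule ext) (metis Der_ext)

lemma Der_space_simps [simp]:
  shows "carrier (Der_space A) = Der A" and "\<zero>\<^bsub>Der_space A\<^esub> = (\<lambda>a\<in>carrier A. \<zero>)"
    and "a \<in> carrier A \<Longrightarrow> (D \<oplus>\<^bsub>Der_space A\<^esub> E) a = D a \<oplus> E a"
    and "a \<in> carrier A \<Longrightarrow> (c \<odot>\<^bsub>Der_space A\<^esub> D) a = c \<odot> D a"
  by (simp_all add: Der_space_def)

lemma DerI:
  assumes "\<And>a. a \<in> carrier A \<Longrightarrow> f a \<in> carrier A"
    and "\<And>a b. a \<in> carrier A \<Longrightarrow> b \<in> carrier A \<Longrightarrow> f (a \<oplus> b) = f a \<oplus> f b"
    and "\<And>c a. a \<in> carrier A \<Longrightarrow> f (c \<odot> a) = c \<odot> f a"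
    and "\<And>a b. a \<in> carrier A \<Longrightarrow> b \<in> carrier A \<Longrightarrow> f (a \<otimes> b) = f a \<otimes> b \<oplus> a \<otimes> f b"
  shows "(\<lambda>a\<in>carrier A. f a) \<in> Der A"
  using assms by (auto simp: Der_def)

lemma Der_zero: "(\<lambda>a\<in>carrier A. \<zero>) \<in> Der A"
  by (rule DerI) (simp_all add: smult_zero_right)

lemma Der_add_closed:
  assumes "D \<in> Der A" "E \<in> Der A"
  shows "D \<oplus>\<^bsub>Der_space A\<^esub> E \<in> Der A"
proof -
  note D = DerD[OF assms(1)] and E = DerD[OF assms(2)]
  have "(\<lambda>a\<in>carrier A. D a \<oplus> E a) \<in> Der A"
    by (rule DerI)
      (simp_all add: D(1,3-5) E(1,3-5) smult_r_distr l_distr r_distr a_ac)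
  then show ?thesis by (simp add: Der_space_def)
qed

lemma Der_smult_closed:
  assumes "D \<in> Der A"
  shows "c \<odot>\<^bsub>Der_space A\<^esub> D \<in> Der A"
proof -
  note D = DerD[OF assms(1)]
  have "c \<odot> (d \<odot> a) = d \<odot> (c \<odot> a)" if "a \<in> carrier A" for a d
    using that smult_assoc[of a c d] smult_assoc[of a d c] by (simp add: mult.commute)
  then have "(\<lambda>a\<in>carrier A. c \<odot> D a) \<in> Der A"
    by (intro DerI) (simp_all add: D(1,3-5) smult_r_distr smult_mult_left smult_mult_right)
  then show ?thesis by (simp add: Der_space_def)
qed

lemma module_Der_space: "module ring_of_type_algebra (Der_space A)"
proof (rule moduleI)
  show "cring (ring_of_type_algebra :: 'k ring)" by (rule cring_from_type_algebra)
  show "abelian_group (Der_space A)"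
  proof (rule abelian_groupI, unfold Der_space_simps(1,2))
    fix D assume D: "D \<in> Der A"
    then show "(\<lambda>a\<in>carrier A. \<zero>) \<oplus>\<^bsub>Der_space A\<^esub> D = D"
      by (intro Der_eqI Der_add_closed Der_zero) (simp_all add: Der_closed)
    show "\<exists>E\<in>Der A. E \<oplus>\<^bsub>Der_space A\<^esub> D = (\<lambda>a\<in>carrier A. \<zero>)"
      by (rule bexI[of _ "(- 1) \<odot>\<^bsub>Der_space A\<^esub> D"],
          intro Der_eqI Der_add_closed Der_smult_closed Der_zero D)
       (simp_all add: smult_minus_one Der_closed[OF D] l_neg Der_smult_closed D)
    fix E assume E: "E \<in> Der A"
    show "D \<oplus>\<^bsub>Der_space A\<^esub> E \<in> Der A" by (rule Der_add_closed[OF D E])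
    show "D \<oplus>\<^bsub>Der_space A\<^esub> E = E \<oplus>\<^bsub>Der_space A\<^esub> D"
      by (intro Der_eqI Der_add_closed D E) (simp add: Der_closed[OF D] Der_closed[OF E] a_comm)
    fix F assume F: "F \<in> Der A"
    show "D \<oplus>\<^bsub>Der_space A\<^esub> E \<oplus>\<^bsub>Der_space A\<^esub> F = D \<oplus>\<^bsub>Der_space A\<^esub> (E \<oplus>\<^bsub>Der_space A\<^esub> F)"
      by (intro Der_eqI Der_add_closed D E F)
        (simp add: Der_closed[OF D] Der_closed[OF E] Der_closed[OF F] a_assoc)
  qed (rule Der_zero)
next
  fix c d :: 'k and D assume "D \<in> carrier (Der_space A)"
  then have D: "D \<in> Der A" by simp
  note [simp] = Der_closed[OF D]
  show "c \<odot>\<^bsub>Der_space A\<^esub> D \<in> carrier (Der_space A)"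
    by (simp add: Der_smult_closed D)
  show "(c \<oplus>\<^bsub>ring_of_type_algebra\<^esub> d) \<odot>\<^bsub>Der_space A\<^esub> D
      = c \<odot>\<^bsub>Der_space A\<^esub> D \<oplus>\<^bsub>Der_space A\<^esub> d \<odot>\<^bsub>Der_space A\<^esub> D"
    by (intro Der_eqI Der_add_closed Der_smult_closed D)
      (simp add: ring_of_type_algebra_def smult_l_distr)
  show "(c \<otimes>\<^bsub>ring_of_type_algebra\<^esub> d) \<odot>\<^bsub>Der_space A\<^esub> D
      = c \<odot>\<^bsub>Der_space A\<^esub> (d \<odot>\<^bsub>Der_space A\<^esub> D)"
    by (intro Der_eqI Der_smult_closed D) (simp add: ring_of_type_algebra_def smult_assoc)
  show "\<one>\<^bsub>ring_of_type_algebra\<^esub> \<odot>\<^bsub>Der_space A\<^esub> D = D"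
    by (intro Der_eqI Der_smult_closed D) (simp add: ring_of_type_algebra_def)
  fix E assume "E \<in> carrier (Der_space A)"
  then have E: "E \<in> Der A" by simp
  show "c \<odot>\<^bsub>Der_space A\<^esub> (D \<oplus>\<^bsub>Der_space A\<^esub> E)
      = c \<odot>\<^bsub>Der_space A\<^esub> D \<oplus>\<^bsub>Der_space A\<^esub> c \<odot>\<^bsub>Der_space A\<^esub> E"
    by (intro Der_eqI Der_add_closed Der_smult_closed D E)
      (simp add: smult_r_distr Der_closed[OF E])
qed

lemma submodule_Der_spaceI:
  assumes "U \<subseteq> Der A" "(\<lambda>a\<in>carrier A. \<zero>) \<in> U"
    and "\<And>D E. D \<in> U \<Longrightarrow> E \<in> U \<Longrightarrow> D \<oplus>\<^bsub>Der_space A\<^esub> E \<in> U"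
    and smult: "\<And>c D. D \<in> U \<Longrightarrow> c \<odot>\<^bsub>Der_space A\<^esub> D \<in> U"
  shows "submodule U ring_of_type_algebra (Der_space A)"
proof -
  interpret V: module ring_of_type_algebra "Der_space A" by (rule module_Der_space)
  show ?thesis
  proof (rule V.submoduleI)
    fix D assume D: "D \<in> U"
    have "\<ominus>\<^bsub>Der_space A\<^esub> D = (- 1) \<odot>\<^bsub>Der_space A\<^esub> D"
    proof (rule V.minus_equality)
      show "(- 1) \<odot>\<^bsub>Der_space A\<^esub> D \<oplus>\<^bsub>Der_space A\<^esub> D = \<zero>\<^bsub>Der_space A\<^esub>"
        unfolding Der_space_simps(2) using D assms(1)
        by (intro Der_eqI Der_add_closed Der_smult_closed Der_zero)
          (auto simp: smult_minus_one Der_closed l_neg)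
    qed (use D assms(1) in \<open>auto intro: Der_smult_closed\<close>)
    then show "\<ominus>\<^bsub>Der_space A\<^esub> D \<in> U" using smult[OF D] by simp
  qed (simp_all only: Der_space_simps assms)
qed

lemma ad_in_Der:
  assumes w: "w \<in> carrier A"
  shows "ad A w \<in> Der A"
proof -
  \<comment> \<open>The Leibniz rule comes from inserting \<open>a w b\<close> between \<open>w a b\<close> and \<open>a b w\<close>.\<close>
  have telescope: "x \<ominus> u = (x \<ominus> y) \<oplus> (y \<ominus> u)"
    if "x \<in> carrier A" "y \<in> carrier A" "u \<in> carrier A" for x y u
    using that by (simp add: a_minus_def a_assoc r_neg1)
  have "w \<otimes> (a \<otimes> b) \<ominus> a \<otimes> b \<otimes> w = (w \<otimes> a \<ominus> a \<otimes> w) \<otimes> b \<oplus> a \<otimes> (w \<otimes> b \<ominus> b \<otimes> w)"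
    if "a \<in> carrier A" "b \<in> carrier A" for a b
    using telescope[of "w \<otimes> a \<otimes> b" "a \<otimes> w \<otimes> b" "a \<otimes> b \<otimes> w"] that w
    by (simp add: a_minus_def l_distr r_distr l_minus r_minus m_assoc)
  moreover have "w \<otimes> (a \<oplus> b) \<ominus> (a \<oplus> b) \<otimes> w = (w \<otimes> a \<ominus> a \<otimes> w) \<oplus> (w \<otimes> b \<ominus> b \<otimes> w)"
    if "a \<in> carrier A" "b \<in> carrier A" for a b
    using that w by (simp add: a_minus_def l_distr r_distr minus_add a_ac)
  ultimately show ?thesis
    unfolding ad_def using w
    by (intro DerI) (simp_all add: smult_mult_left smult_mult_right smult_diff)
qed

lemma ad_add:
  assumes "v \<in> carrier A" "w \<in> carrier A"
  shows "ad A v \<oplus>\<^bsub>Der_space A\<^esub> ad A w = ad A (v \<oplus> w)"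
  using assms
  by (intro Der_eqI Der_add_closed ad_in_Der)
    (simp_all add: ad_def a_minus_def l_distr r_distr minus_add a_ac)

lemma ad_smult:
  assumes "w \<in> carrier A"
  shows "c \<odot>\<^bsub>Der_space A\<^esub> ad A w = ad A (c \<odot> w)"
  using assms
  by (intro Der_eqI Der_smult_closed ad_in_Der)
    (simp_all add: ad_def smult_diff smult_mult_left smult_mult_right)

lemma ad_zero: "ad A \<zero> = (\<lambda>a\<in>carrier A. \<zero>)"
  by (auto simp: ad_def a_minus_def r_neg)

lemma submodule_Inn: "submodule (Inn A) ring_of_type_algebra (Der_space A)"
proof (rule submodule_Der_spaceI)
  show "(\<lambda>a\<in>carrier A. \<zero>) \<in> Inn A"
    unfolding Inn_def ad_zero[symmetric] by blast
qed (auto simp: Inn_def ad_in_Der ad_add ad_smult)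

lemma submodule_line:
  assumes "D \<in> Der A"
  shows "submodule (line (Der_space A) D) ring_of_type_algebra (Der_space A)"
proof (rule submodule_Der_spaceI)
  show "(\<lambda>a\<in>carrier A. \<zero>) \<in> line (Der_space A) D"
    unfolding line_def
    by (rule range_eqI[of _ _ 0], intro Der_eqI Der_smult_closed Der_zero assms)
      (simp add: smult_zero_left Der_closed assms)
  fix E F c assume "E \<in> line (Der_space A) D" "F \<in> line (Der_space A) D"
  then obtain a b where E: "E = a \<odot>\<^bsub>Der_space A\<^esub> D" and F: "F = b \<odot>\<^bsub>Der_space A\<^esub> D"
    by (auto simp: line_def)
  show "E \<oplus>\<^bsub>Der_space A\<^esub> F \<in> line (Der_space A) D"
    unfolding line_def E F
    by (rule range_eqI[of _ _ "a + b"], intro Der_eqI Der_add_closed Der_smult_closed assms)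
      (simp add: smult_l_distr Der_closed assms)
next
  fix E c assume "E \<in> line (Der_space A) D"
  then obtain a where E: "E = a \<odot>\<^bsub>Der_space A\<^esub> D"
    by (auto simp: line_def)
  show "c \<odot>\<^bsub>Der_space A\<^esub> E \<in> line (Der_space A) D"
    unfolding line_def E
    by (rule range_eqI[of _ _ "c * a"], intro Der_eqI Der_smult_closed assms)
      (simp add: smult_assoc Der_closed assms)
qed (auto simp: line_def intro: Der_smult_closed assms)

end

section \<open>The quotient algebra as an algebra of operators\<close>

definition weyl_coset :: "'k::field \<Rightarrow> (weyl_letter monomial \<Rightarrow>\<^sub>0 'k) \<Rightarrow> (weyl_letter monomial \<Rightarrow>\<^sub>0 'k) set"
  where "weyl_coset q p = weyl_ideal q +>\<^bsub>free_algebra\<^esub> p"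

lemma mem_weyl_coset: "a \<in> weyl_coset q p \<longleftrightarrow> weyl_cong q a p"
  by (auto simp: weyl_coset_def a_r_coset_def' free_algebra_def weyl_cong_def intro!: bexI[of _ "a - p"])

lemma weyl_coset_eq_iff: "weyl_coset q p = weyl_coset q r \<longleftrightarrow> weyl_cong q p r"
proof
  show "weyl_coset q p = weyl_coset q r \<Longrightarrow> weyl_cong q p r"
    using weyl_cong_refl[of q p] mem_weyl_coset by blast
  show "weyl_cong q p r \<Longrightarrow> weyl_coset q p = weyl_coset q r"
    unfolding set_eq_iff mem_weyl_coset using weyl_cong_trans weyl_cong_sym by blast
qed

lemma quantum_weyl_simps:
  shows carrier_quantum_weyl: "carrier (quantum_weyl q) = range (weyl_coset q)"
    and "weyl_coset q p \<oplus>\<^bsub>quantum_weyl q\<^esub> weyl_coset q r = weyl_coset q (p + r)"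
    and "weyl_coset q p \<otimes>\<^bsub>quantum_weyl q\<^esub> weyl_coset q r = weyl_coset q (p * r)"
    and "\<zero>\<^bsub>quantum_weyl q\<^esub> = weyl_coset q 0"
    and "\<one>\<^bsub>quantum_weyl q\<^esub> = weyl_coset q 1"
    and "c \<odot>\<^bsub>quantum_weyl q\<^esub> weyl_coset q p = weyl_coset q (const c * p)"
proof -
  interpret ideal "weyl_ideal q" free_algebra by (rule ideal_weyl_ideal)
  show "carrier (quantum_weyl q) = range (weyl_coset q)"
    by (auto simp: quantum_weyl_def quot_algebra_def FactRing_def A_RCOSETS_def' weyl_coset_def free_algebra_def)
  show "weyl_coset q p \<oplus>\<^bsub>quantum_weyl q\<^esub> weyl_coset q r = weyl_coset q (p + r)"
    using a_rcos_sum[of p r]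
    by (simp add: quantum_weyl_def quot_algebra_def FactRing_def weyl_coset_def)
      (simp add: free_algebra_def)
  show "weyl_coset q p \<otimes>\<^bsub>quantum_weyl q\<^esub> weyl_coset q r = weyl_coset q (p * r)"
    using rcoset_mult_add[of p r]
    by (simp add: quantum_weyl_def quot_algebra_def FactRing_def weyl_coset_def)
      (simp add: free_algebra_def)
  show "\<zero>\<^bsub>quantum_weyl q\<^esub> = weyl_coset q 0"
    by (auto simp: quantum_weyl_def quot_algebra_def FactRing_def mem_weyl_coset weyl_cong_def)
  show "\<one>\<^bsub>quantum_weyl q\<^esub> = weyl_coset q 1"
    by (simp add: quantum_weyl_def quot_algebra_def FactRing_def weyl_coset_def) (simp add: free_algebra_def)
  have "c \<odot>\<^bsub>quantum_weyl q\<^esub> weyl_coset q p = (\<Union>a\<in>weyl_coset q p. weyl_coset q (const c * a))"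
    by (simp add: quantum_weyl_def quot_algebra_def weyl_coset_def smult_free_algebra)
  also have "\<dots> = (\<Union>a\<in>weyl_coset q p. weyl_coset q (const c * p))"
    by (intro SUP_cong refl) (simp add: weyl_coset_eq_iff mem_weyl_coset weyl_cong_mult_left)
  also have "\<dots> = weyl_coset q (const c * p)"
    using weyl_cong_refl[of q p] by (auto simp: mem_weyl_coset)
  finally show "c \<odot>\<^bsub>quantum_weyl q\<^esub> weyl_coset q p = weyl_coset q (const c * p)" .
qed

lemma ring_quantum_weyl: "ring (quantum_weyl q)"
proof (intro ringI abelian_groupI monoidI)
  fix a assume "a \<in> carrier (quantum_weyl q)"
  then obtain p where "a = weyl_coset q p" by (auto simp: quantum_weyl_simps)
  then show "\<exists>b\<in>carrier (quantum_weyl q). b \<oplus>\<^bsub>quantum_weyl q\<^esub> a = \<zero>\<^bsub>quantum_weyl q\<^esub>"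
    by (intro bexI[of _ "weyl_coset q (- p)"]) (simp_all add: quantum_weyl_simps)
qed (auto simp: quantum_weyl_simps add_ac mult.assoc distrib_left distrib_right)

lemma k_algebra_quantum_weyl: "k_algebra (quantum_weyl q)"
proof (intro k_algebra.intro k_algebra_axioms.intro ring_quantum_weyl)
  fix a b c assume "a \<in> carrier (quantum_weyl q)" "b \<in> carrier (quantum_weyl q)"
  then obtain p r where "a = weyl_coset q p" "b = weyl_coset q r" by (auto simp: quantum_weyl_simps)
  then show "a \<otimes>\<^bsub>quantum_weyl q\<^esub> (c \<odot>\<^bsub>quantum_weyl q\<^esub> b)
      = c \<odot>\<^bsub>quantum_weyl q\<^esub> (a \<otimes>\<^bsub>quantum_weyl q\<^esub> b)"
    by (simp add: quantum_weyl_simps const_left_commute)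
qed (auto simp: quantum_weyl_simps single_add distrib_left distrib_right mult.assoc
    simp flip: const_mult)

text \<open>
  The choice of a representative does not matter as soon as the ideal lies in the kernel of the
  representation, that is, for \<open>q \<noteq> 1\<close>.
\<close>

definition opr :: "'k::field \<Rightarrow> (weyl_letter monomial \<Rightarrow>\<^sub>0 'k) set \<Rightarrow> 'k seq_endo"
  where "opr q a = rep q (SOME p. a = weyl_coset q p)"

context non_root
begin

abbreviation A where "A \<equiv> quantum_weyl q"
abbreviation V where "V \<equiv> Der_space A"

sublocale A: k_algebra A by (rule k_algebra_quantum_weyl)

lemma weyl_coset_eq_iff_rep: "weyl_coset q p = weyl_coset q r \<longleftrightarrow> rep q p = rep q r"
  using rep_eq_0_iff[of "p - r"]
  by (simp add: weyl_coset_eq_iff weyl_cong_def rep_diff)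

lemma opr_weyl_coset [simp]: "opr q (weyl_coset q p) = rep q p"
proof -
  have "weyl_coset q p = weyl_coset q (SOME r. weyl_coset q p = weyl_coset q r)"
    by (rule someI) (rule refl)
  then show ?thesis by (simp only: weyl_coset_eq_iff_rep opr_def)
qed

lemma weyl_coset_mem [simp]: "weyl_coset q p \<in> carrier A"
  by (simp add: quantum_weyl_simps)

lemma carrier_cases:
  assumes "a \<in> carrier A"
  obtains p where "a = weyl_coset q p"
  using assms by (auto simp: quantum_weyl_simps)

lemma opr_simps:
  shows "a \<in> carrier A \<Longrightarrow> b \<in> carrier A \<Longrightarrow> opr q (a \<oplus>\<^bsub>A\<^esub> b) = opr q a + opr q b"
    and "a \<in> carrier A \<Longrightarrow> b \<in> carrier A \<Longrightarrow> opr q (a \<otimes>\<^bsub>A\<^esub> b) = opr q a * opr q b"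
    and "a \<in> carrier A \<Longrightarrow> opr q (c \<odot>\<^bsub>A\<^esub> a) = pol q [:c:] * opr q a"
  by (auto elim!: carrier_cases simp: quantum_weyl_simps rep_add rep_mult)

lemma opr_uminus:
  assumes "a \<in> carrier A"
  shows "opr q (\<ominus>\<^bsub>A\<^esub> a) = - opr q a"
proof -
  have "opr q (\<ominus>\<^bsub>A\<^esub> a \<oplus>\<^bsub>A\<^esub> a) = 0"
    by (simp only: A.l_neg assms quantum_weyl_simps(4) opr_weyl_coset rep_0)
  then show ?thesis by (simp add: opr_simps assms eq_neg_iff_add_eq_0)
qed

lemma opr_diff: "a \<in> carrier A \<Longrightarrow> b \<in> carrier A \<Longrightarrow> opr q (a \<ominus>\<^bsub>A\<^esub> b) = opr q a - opr q b"
  by (simp add: a_minus_def opr_simps opr_uminus)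

lemma opr_inject: "a \<in> carrier A \<Longrightarrow> b \<in> carrier A \<Longrightarrow> opr q a = opr q b \<longleftrightarrow> a = b"
  by (metis carrier_cases opr_weyl_coset weyl_coset_eq_iff_rep)

lemma opr_mem: "a \<in> carrier A \<Longrightarrow> opr q a \<in> weyl_alg q"
  by (metis carrier_cases opr_weyl_coset weyl_alg_rep)

lemma opr_surj:
  assumes "s \<in> weyl_alg q"
  obtains a where "a \<in> carrier A" "opr q a = s"
proof -
  obtain p where "s = rep q p" using assms by (auto simp: weyl_alg_def)
  then show ?thesis using that[of "weyl_coset q p"] by simp
qed

text \<open>
  These are the three hypotheses of the decomposition of derivations along the representation.
\<close>

lemma rep_der_of_Der:
  assumes "D \<in> Der A"
  shows "rep_der q (\<lambda>p. opr q (D (weyl_coset q p)))"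
    and "p \<in> weyl_ideal q \<Longrightarrow> opr q (D (weyl_coset q p)) = 0"
    and "opr q (D (weyl_coset q p)) \<in> weyl_alg q"
proof -
  note D = A.DerD[OF assms]
  note [simp] = D(1)
  have one: "opr q (D (weyl_coset q 1)) = 0"
    using arg_cong[OF D(5)[of "weyl_coset q 1" "weyl_coset q 1"], of "opr q"]
    by (simp add: quantum_weyl_simps(3) opr_simps)
  have add: "opr q (D (weyl_coset q (p + r))) = opr q (D (weyl_coset q p)) + opr q (D (weyl_coset q r))" for p r
    using D(3)[of "weyl_coset q p" "weyl_coset q r"] by (simp add: quantum_weyl_simps(2) opr_simps)
  have "opr q (D (weyl_coset q (p * r)))
      = opr q (D (weyl_coset q p)) * rep q r + rep q p * opr q (D (weyl_coset q r))" for p r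
    using D(5)[of "weyl_coset q p" "weyl_coset q r"] by (simp add: quantum_weyl_simps(3) opr_simps)
  moreover have "opr q (D (weyl_coset q (const c))) = 0" for c
    using D(4)[of "weyl_coset q 1" c] one by (simp add: quantum_weyl_simps(6) opr_simps)
  ultimately show "rep_der q (\<lambda>p. opr q (D (weyl_coset q p)))"
    using add by (simp add: rep_der_def)
  show "opr q (D (weyl_coset q p)) = 0" if "p \<in> weyl_ideal q"
  proof -
    have "weyl_coset q p = weyl_coset q 0"
      using that by (simp add: weyl_coset_eq_iff weyl_cong_def)
    then show ?thesis using add[of 0 0] by simp
  qed
  show "opr q (D (weyl_coset q p)) \<in> weyl_alg q" by (simp add: opr_mem)
qed

lemma opr_ad:
  assumes "w \<in> carrier A" "a \<in> carrier A"
  shows "opr q (ad A w a) = bracket (opr q w) (opr q a)"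
  using assms by (simp add: ad_def opr_simps opr_diff bracket_def)

text \<open>
  The commutator with \<open>t d/dt\<close> preserves the operators coming from the quotient, so it can be
  pulled back to a derivation there although \<open>t d/dt\<close> itself is not such an operator.
\<close>

definition euler_der where "euler_der = (\<lambda>a\<in>carrier A. THE b. b \<in> carrier A \<and> opr q b = bracket euler (opr q a))"

lemma euler_der_apply:
  assumes "a \<in> carrier A"
  shows "euler_der a \<in> carrier A \<and> opr q (euler_der a) = bracket euler (opr q a)"
proof -
  obtain p where p: "a = weyl_coset q p" using assms by (rule carrier_cases)
  obtain b where "b \<in> carrier A" "opr q b = bracket euler (opr q a)"
    using opr_surj[OF bracket_euler_mem[of q p]] p by auto
  then have "\<exists>!b. b \<in> carrier A \<and> opr q b = bracket euler (opr q a)"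
    by (metis opr_inject)
  from theI'[OF this] show ?thesis
    using assms by (simp add: euler_der_def)
qed

lemma euler_der_in_Der: "euler_der \<in> Der A"
proof -
  note E [simp] = euler_der_apply
  have const: "bracket euler (pol q [:c:] * s) = pol q [:c:] * bracket euler s" for c and s :: "'k seq_endo"
    using arg_cong[OF euler_pol[of q "[:c:]"], of "\<lambda>t. t * s"]
    by (simp add: bracket_def right_diff_distrib mult.assoc)
  have "(\<lambda>a\<in>carrier A. euler_der a) \<in> Der A"
    by (rule A.DerI; (subst opr_inject[symmetric])?)
      (simp_all add: opr_simps const, simp_all add: bracket_def algebra_simps)
  moreover have "(\<lambda>a\<in>carrier A. euler_der a) = euler_der"
    by (simp add: euler_der_def fun_eq_iff)
  ultimately show ?thesis by simp
qed

lemma weyl_gens: "weyl_X q = weyl_coset q (free_gen LX)" "weyl_Y q = weyl_coset q (free_gen LY)"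
  by (simp_all add: weyl_X_def weyl_Y_def weyl_coset_def)

lemma is_weyl_H_iff: "is_weyl_H q H \<longleftrightarrow> H = euler_der"
proof
  assume "H = euler_der"
  moreover have "euler_der (weyl_X q) = weyl_X q" "euler_der (weyl_Y q) = \<ominus>\<^bsub>A\<^esub> weyl_Y q"
    by (subst opr_inject[symmetric];
        simp add: weyl_gens euler_der_apply opr_uminus bracket_def euler_shift euler_lower)+
  ultimately show "is_weyl_H q H"
    by (simp add: is_weyl_H_def euler_der_in_Der)
next
  assume "is_weyl_H q H"
  then have H: "H \<in> Der A" "H (weyl_X q) = weyl_X q" "H (weyl_Y q) = \<ominus>\<^bsub>A\<^esub> weyl_Y q"
    by (auto simp: is_weyl_H_def)
  show "H = euler_der"
  proof (rule A.Der_eqI[OF H(1) euler_der_in_Der])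
    fix a assume "a \<in> carrier A"
    then obtain p where p: "a = weyl_coset q p" by (rule carrier_cases)
    have "opr q (H (weyl_coset q p)) = bracket euler (rep q p)"
    proof (rule rep_der_eqI[OF rep_der_of_Der(1)[OF H(1)] rep_der_euler])
      show "opr q (H (weyl_coset q (free_gen x))) = bracket euler (rep q (free_gen x))" for x
        using H(2,3) opr_uminus[of "weyl_Y q"]
        by (cases x) (simp_all add: weyl_gens bracket_def euler_shift euler_lower)
    qed
    then have "opr q (H a) = opr q (euler_der a)"
      by (simp add: p euler_der_apply)
    then show "H a = euler_der a"
      using \<open>a \<in> carrier A\<close> opr_inject A.Der_closed[OF H(1)] euler_der_apply by blast
  qed
qed

lemma weyl_H_eq: "weyl_H q = euler_der"
  unfolding weyl_H_def is_weyl_H_iff by (rule the_eq_trivial)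

lemma Der_eq_ad_plus_euler_iff:
  assumes D: "D \<in> Der A" and w: "w \<in> carrier A"
  shows "D = ad A w \<oplus>\<^bsub>V\<^esub> (c \<odot>\<^bsub>V\<^esub> euler_der) \<longleftrightarrow>
    (\<forall>p. opr q (D (weyl_coset q p))
      = bracket (opr q w) (rep q p) + pol q [:c:] * bracket euler (rep q p))"
    (is "D = ?E \<longleftrightarrow> ?R")
proof -
  have E: "?E \<in> Der A"
    by (intro A.Der_add_closed A.Der_smult_closed A.ad_in_Der w euler_der_in_Der)
  have opr_E: "opr q (?E (weyl_coset q p))
      = bracket (opr q w) (rep q p) + pol q [:c:] * bracket euler (rep q p)" for p
    using A.Der_closed[OF A.ad_in_Der[OF w], of "weyl_coset q p"] euler_der_apply[of "weyl_coset q p"]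
    by (simp add: opr_simps opr_ad w)
  show ?thesis
  proof
    assume R: ?R
    show "D = ?E"
    proof (rule A.Der_eqI[OF D E])
      fix a assume a: "a \<in> carrier A"
      then obtain p where "a = weyl_coset q p" by (rule carrier_cases)
      then have "opr q (D a) = opr q (?E a)" using R by (simp only: opr_E)
      then show "D a = ?E a"
        using opr_inject A.Der_closed[OF D a] A.Der_closed[OF E a] by blast
    qed
  qed (use opr_E in blast)
qed

lemma Der_decomposition:
  assumes D: "D \<in> Der A"
  shows "\<exists>w\<in>carrier A. \<exists>c. D = ad A w \<oplus>\<^bsub>V\<^esub> (c \<odot>\<^bsub>V\<^esub> euler_der)"
proof -
  obtain s c where "s \<in> weyl_alg q"
    and s: "\<And>p. opr q (D (weyl_coset q p)) = bracket s (rep q p) + pol q [:c:] * bracket euler (rep q p)"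
    using rep_der_decomposition[OF rep_der_of_Der[OF D]] by blast
  moreover obtain w where "w \<in> carrier A" "opr q w = s"
    using \<open>s \<in> weyl_alg q\<close> by (rule opr_surj)
  ultimately show ?thesis
    using Der_eq_ad_plus_euler_iff[OF D] by blast
qed

text \<open>
  An element is central exactly when its inner derivation vanishes, which explains the ambiguity of
  \<open>w\<close> in the decomposition.
\<close>

lemma mem_center_iff:
  assumes "z \<in> carrier A"
  shows "z \<in> algebra_center A \<longleftrightarrow> (\<forall>p. bracket (opr q z) (rep q p) = 0)"
proof -
  have "z \<otimes>\<^bsub>A\<^esub> weyl_coset q p = weyl_coset q p \<otimes>\<^bsub>A\<^esub> z \<longleftrightarrow> bracket (opr q z) (rep q p) = 0" for p
    using opr_inject[of "z \<otimes>\<^bsub>A\<^esub> weyl_coset q p" "weyl_coset q p \<otimes>\<^bsub>A\<^esub> z"] assms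
    by (simp add: opr_simps bracket_def)
  then show ?thesis
    using assms by (auto simp: algebra_center_def carrier_quantum_weyl)
qed

lemma decomposition_unique:
  assumes D: "D \<in> Der A" and w: "w \<in> carrier A" "w' \<in> carrier A"
    and eq: "D = ad A w \<oplus>\<^bsub>V\<^esub> (c \<odot>\<^bsub>V\<^esub> euler_der)"
  shows "D = ad A w' \<oplus>\<^bsub>V\<^esub> (c' \<odot>\<^bsub>V\<^esub> euler_der) \<longleftrightarrow>
    c' = c \<and> w' \<ominus>\<^bsub>A\<^esub> w \<in> algebra_center A"
proof -
  have Dw: "opr q (D (weyl_coset q p))
      = bracket (opr q w) (rep q p) + pol q [:c:] * bracket euler (rep q p)" for p
    using Der_eq_ad_plus_euler_iff[OF D w(1)] eq by blast
  have bracket_diff: "bracket (opr q (w' \<ominus>\<^bsub>A\<^esub> w)) s = bracket (opr q w') s - bracket (opr q w) s" for s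
    using w by (simp add: opr_diff bracket_def algebra_simps)
  have const_diff: "pol q [:c - c':] * s = pol q [:c:] * s - pol q [:c':] * s" for s
    using pol_diff[of q "[:c:]" "[:c':]"] by (simp add: left_diff_distrib)
  have "D = ad A w' \<oplus>\<^bsub>V\<^esub> (c' \<odot>\<^bsub>V\<^esub> euler_der) \<longleftrightarrow>
    (\<forall>p. bracket (opr q (w' \<ominus>\<^bsub>A\<^esub> w)) (rep q p) = pol q [:c - c':] * bracket euler (rep q p))"
    unfolding Der_eq_ad_plus_euler_iff[OF D w(2)] Dw bracket_diff const_diff
    by (auto simp: algebra_simps)
  also have "\<dots> \<longleftrightarrow> c - c' = 0 \<and> (\<forall>p. bracket (opr q (w' \<ominus>\<^bsub>A\<^esub> w)) (rep q p) = 0)"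
    using euler_not_inner[OF opr_mem[of "w' \<ominus>\<^bsub>A\<^esub> w"], of "c - c'"] w by auto
  finally show ?thesis
    using mem_center_iff[of "w' \<ominus>\<^bsub>A\<^esub> w"] w by auto
qed

lemma Inn_inter_line: "Inn A \<inter> line V euler_der = {\<zero>\<^bsub>V\<^esub>}"
proof -
  interpret V: module ring_of_type_algebra V by (rule A.module_Der_space)
  have zero: "\<zero>\<^bsub>V\<^esub> = ad A \<zero>\<^bsub>A\<^esub>"
    by (simp add: A.ad_zero)
  have "D = \<zero>\<^bsub>V\<^esub>" if inner: "D \<in> Inn A" and outer: "D \<in> line V euler_der" for D
  proof -
    obtain w where w: "w \<in> carrier A" "D = ad A w"
      using inner by (auto simp: Inn_def)
    obtain c where c: "D = c \<odot>\<^bsub>V\<^esub> euler_der"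
      using outer by (auto simp: line_def)
    have D: "D \<in> Der A" using A.ad_in_Der w by simp
    have H0: "0 \<odot>\<^bsub>V\<^esub> euler_der = \<zero>\<^bsub>V\<^esub>"
      using V.smult_l_null[of euler_der] euler_der_in_Der by (simp add: ring_of_type_algebra_def)
    have "D = ad A w \<oplus>\<^bsub>V\<^esub> (0 \<odot>\<^bsub>V\<^esub> euler_der)"
      unfolding H0 using w D V.r_zero[of D] by simp
    moreover have "D = ad A \<zero>\<^bsub>A\<^esub> \<oplus>\<^bsub>V\<^esub> (c \<odot>\<^bsub>V\<^esub> euler_der)"
      using D V.l_zero[of D] by (simp only: zero[symmetric] c[symmetric] A.Der_space_simps)
    ultimately have "c = 0"
      using decomposition_unique[OF D w(1) A.zero_closed] by blast
    then show ?thesis using c H0 by simp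
  qed
  moreover have "\<zero>\<^bsub>V\<^esub> \<in> Inn A" "\<zero>\<^bsub>V\<^esub> \<in> line V euler_der"
    using submodule.axioms(1)[OF A.submodule_Inn] submodule.axioms(1)[OF A.submodule_line[OF euler_der_in_Der]]
    by (auto dest: subgroup.one_closed)
  ultimately show ?thesis by blast
qed

lemma Inn_plus_line: "Der A = Inn A <+>\<^bsub>V\<^esub> line V euler_der"
proof
  show "Der A \<subseteq> Inn A <+>\<^bsub>V\<^esub> line V euler_der"
    using Der_decomposition by (fastforce simp: set_add_def' Inn_def line_def)
  show "Inn A <+>\<^bsub>V\<^esub> line V euler_der \<subseteq> Der A"
    by (auto simp: set_add_def' Inn_def line_def
      intro!: A.Der_add_closed A.Der_smult_closed A.ad_in_Der euler_der_in_Der)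
qed

lemma direct_sum: "is_internal_direct_sum V (Inn A) (line V euler_der)"
  unfolding is_internal_direct_sum_def A.Der_space_simps(1)
  using A.module_Der_space A.submodule_Inn A.submodule_line[OF euler_der_in_Der]
    Inn_plus_line Inn_inter_line
  by blast

end

theorem proposition7:
  fixes q :: "'k::{alg_closed_field, field_char_0}"
  assumes "q \<noteq> 0"
    and "\<forall>n::nat. n > 0 \<longrightarrow> q ^ n \<noteq> 1"
  shows "(\<exists>!H. is_weyl_H q H) \<and>
    (let A = quantum_weyl q; V = Der_space A; H = weyl_H q in
      is_internal_direct_sum V (Inn A) (line V H) \<and>
      (\<forall>D\<in>Der A. \<exists>w\<in>carrier A. \<exists>c.
         D = ad A w \<oplus>\<^bsub>V\<^esub> (c \<odot>\<^bsub>V\<^esub> H) \<and>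
         (\<forall>w'\<in>carrier A. \<forall>c'.
            D = ad A w' \<oplus>\<^bsub>V\<^esub> (c' \<odot>\<^bsub>V\<^esub> H) \<longleftrightarrow>
            c' = c \<and> w' \<ominus>\<^bsub>A\<^esub> w \<in> algebra_center A)))"
proof -
  interpret non_root q by unfold_locales (fact assms)+
  have "\<exists>w\<in>carrier A. \<exists>c. D = ad A w \<oplus>\<^bsub>V\<^esub> (c \<odot>\<^bsub>V\<^esub> euler_der) \<and>
      (\<forall>w'\<in>carrier A. \<forall>c'. D = ad A w' \<oplus>\<^bsub>V\<^esub> (c' \<odot>\<^bsub>V\<^esub> euler_der) \<longleftrightarrow>
        c' = c \<and> w' \<ominus>\<^bsub>A\<^esub> w \<in> algebra_center A)" if D: "D \<in> Der A" for D
  proof -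
    obtain w c where w: "w \<in> carrier A" and eq: "D = ad A w \<oplus>\<^bsub>V\<^esub> (c \<odot>\<^bsub>V\<^esub> euler_der)"
      using Der_decomposition[OF D] by blast
    have "\<forall>w'\<in>carrier A. \<forall>c'. D = ad A w' \<oplus>\<^bsub>V\<^esub> (c' \<odot>\<^bsub>V\<^esub> euler_der) \<longleftrightarrow>
        c' = c \<and> w' \<ominus>\<^bsub>A\<^esub> w \<in> algebra_center A"
      using decomposition_unique[OF D w _ eq] by blast
    with w eq show ?thesis by blast
  qed
  moreover have "\<exists>!H. is_weyl_H q H" by (simp add: is_weyl_H_iff)
  ultimately show ?thesis
    unfolding Let_def weyl_H_eq using direct_sum by blast
qed

end
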